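(* Let $W_0:\mathbb{R}^d\times\mathcal{P}_2(\mathbb{R}^d)\to\mathbb{R}^d$ and $F,G:\mathbb{R}^d\times\mathcal{P}_2(\mathbb{R}^d)\times\mathbb{R}^d\to\mathbb{R}^d$ be continuous. Assume: (1) there is a constant $C_1$ with $|W_0(x,\mu)|+|F(x,\mu,u)|+|G(x,\mu,u)|\le C_1(1+|x|+|u|+\sqrt{E_2(\mu)})$ for all $(x,\mu,u)$; (2) there exist $\alpha>0$, $L\ge0$ such that for all $X,Y,U,V\in\mathcal{H}$: $\langle\tilde W_0(X)-\tilde W_0(Y),X-Y\rangle\ge0$; $\langle\tilde G(X,U)-\tilde G(Y,V),X-Y\rangle+\langle\tilde F(X,U)-\tilde F(Y,V),U-V\rangle\ge0$; $\langle\tilde G(X,U)-\tilde G(Y,V),X-Y\rangle+\langle\tilde F(X,U)-\tilde F(Y,V),U-V\rangle\ge\alpha\|U-V\|^2-L\|X-Y\|^2$; (3) there exist $\gamma\in(0,1]$, a constant $C_2$ and a modulus of continuity $\omega$ such that for all $X,Y,U,V\in\mathcal{H}$: $\langle\tilde G(X,U)-\tilde G(Y,V),U-V\rangle\le C_2(\|X-Y\|_\gamma^2+\|U-V\|^2)$; $\langle\tilde F(X,U)-\tilde F(Y,V),X-Y\rangle\ge-C_2(\|X-Y\|^2+\|U-V\|^2)$; $\|\tilde W_0(X)-\tilde W_0(Y)\|\le C_2\|X-Y\|_\gamma$; and for all $x,u\in\mathbb{R}^d$, $\mu,\nu\in\mathcal{P}_2(\mathbb{R}^d)$: $|F(x,\mu,u)-F(x,\nu,u)|+|G(x,\mu,u)-G(x,\nu,u)|+|W_0(x,\mu)-W_0(x,\nu)|\le\omega(\mathcal{W}_2(\mu,\nu))$.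 Then there exists a constant $C$ such that, whenever $(X,W^x,Z^x)$ and $(Y,W^y,Z^y)$ are strong solutions on $[0,T]$ of $$X_t=X_0-\int_0^t\tilde F(X_s,W_s)ds+\sigma_xB_t,\qquad W_t=\tilde W_0(X_T)+\int_t^T\tilde G(X_s,W_s)ds-\int_t^TZ_sdB_s$$ with initial data $X_0\in\mathcal{H}$ and $Y_0\in\mathcal{H}$ respectively, for all $t\le T$, $$\|W^x_t-W^y_t\|\le C\|X_0-Y_0\|_{\frac{\gamma}{2-\gamma}},\qquad\|X_t-Y_t\|\le C\|X_0-Y_0\|_{\frac{1}{2-\gamma}}.$$
   Context: Fix $d\ge1$, $T>0$, $\sigma_x\ge0$ and a sufficiently rich probability space. $\mathcal{H}=L^2(\Omega,\mathbb{R}^d)$ with $\langle X,Y\rangle=\mathbb{E}[X\cdot Y]$, norm $\|\cdot\|$; for an exponent $\eta\in(0,1]$, $\|X-Y\|_\eta=\max(\|X-Y\|,\|X-Y\|^\eta)$; $\mathcal{L}(X)$ is the law of $X$; $\mathcal{P}_2(\mathbb{R}^d)$ carries $\mathcal{W}_2$; $E_2(\mu)=\int|y|^2\mu(dy)$. A modulus of continuity is a continuous increasing $\omega:\mathbb{R}^+\to\mathbb{R}^+$ with $\omega(0)=0$. Lifts: $\tilde W_0(X)=W_0(X,\mathcal{L}(X))$, $\tilde F(X,U)=F(X,\mathcal{L}(X),U)$, $\tilde G(X,U)=G(X,\mathcal{L}(X),U)$. $B$ is a $d$-dimensional Brownian motion (the same for both solutions) with respect to a filtration for which $X_0,Y_0$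 are measurable at time $0$. A strong solution is a triple of adapted, square integrable processes (with $X_t,W_t\in\mathcal{H}$ and $Z$ square integrable with respect to $dt\otimes\mathbb{P}$) satisfying the system. The constant $C$ depends only on the data ($F,G,W_0,T$), not on the solutions. *)

theory Defs
  imports "HOL-Probability.Probability"
begin

definition L2_rv :: "'a measure \<Rightarrow> ('a \<Rightarrow> 'b::euclidean_space) set" where
  "L2_rv M = {X \<in> borel_measurable M. integrable M (\<lambda>\<omega>. (norm (X \<omega>))\<^sup>2)}"

definition L2_inner :: "'a measure \<Rightarrow> ('a \<Rightarrow> 'b::euclidean_space) \<Rightarrow> ('a \<Rightarrow> 'b) \<Rightarrow> real" where
  "L2_inner M X Y = (\<integral>\<omega>. X \<omega> \<bullet> Y \<omega> \<partial>M)"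

definition L2_nrm :: "'a measure \<Rightarrow> ('a \<Rightarrow> 'b::euclidean_space) \<Rightarrow> real" where
  "L2_nrm M X = sqrt (L2_inner M X X)"

definition L2_nrm_exp :: "'a measure \<Rightarrow> real \<Rightarrow> ('a \<Rightarrow> 'b::euclidean_space) \<Rightarrow> real" where
  "L2_nrm_exp M \<eta> X = max (L2_nrm M X) (L2_nrm M X powr \<eta>)"

text \<open>A sufficiently rich probability space is one carrying a random variable that is uniform on
  the unit interval; every Borel law on a Euclidean space is then the law of a random variable.\<close>

definition rich_prob_space :: "'a measure \<Rightarrow> bool" where
  "rich_prob_space M \<longleftrightarrow> prob_space M \<and>
     (\<exists>U \<in> borel_measurable M. distr M lborel U = uniform_measure lborel {0..1::real})"

definition P2 :: "'b::euclidean_space measure set" where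
  "P2 = {\<mu>. prob_space \<mu> \<and> sets \<mu> = sets borel \<and> integrable \<mu> (\<lambda>y. (norm y)\<^sup>2)}"

definition E2 :: "'b::euclidean_space measure \<Rightarrow> real" where
  "E2 \<mu> = (\<integral>y. (norm y)\<^sup>2 \<partial>\<mu>)"

definition couplings :: "'b::euclidean_space measure \<Rightarrow> 'b measure \<Rightarrow> ('b \<times> 'b) measure set" where
  "couplings \<mu> \<nu> = {\<pi>. prob_space \<pi> \<and> sets \<pi> = sets (borel \<Otimes>\<^sub>M borel) \<and>
     distr \<pi> borel fst = \<mu> \<and> distr \<pi> borel snd = \<nu>}"

definition W2 :: "'b::euclidean_space measure \<Rightarrow> 'b measure \<Rightarrow> real" where
  "W2 \<mu> \<nu> = sqrt (INF \<pi> \<in> couplings \<mu> \<nu>. \<integral>p. (dist (fst p) (snd p))\<^sup>2 \<partial>\<pi>)"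

definition continuous_P2 ::
    "('x::metric_space \<Rightarrow> 'b::euclidean_space measure \<Rightarrow> 'c::metric_space) \<Rightarrow> bool" where
  "continuous_P2 f \<longleftrightarrow> (\<forall>x. \<forall>\<mu>\<in>P2. \<forall>\<epsilon>>0. \<exists>\<delta>>0. \<forall>y. \<forall>\<nu>\<in>P2.
     dist y x < \<delta> \<and> W2 \<nu> \<mu> < \<delta> \<longrightarrow> dist (f y \<nu>) (f x \<mu>) < \<epsilon>)"

definition modulus_of_continuity :: "(real \<Rightarrow> real) \<Rightarrow> bool" where
  "modulus_of_continuity w \<longleftrightarrow> continuous_on {0..} w \<and> mono_on {0..} w \<and> w 0 = 0"

definition lift0 :: "'a measure \<Rightarrow> ('b::euclidean_space \<Rightarrow> 'b measure \<Rightarrow> 'b) \<Rightarrow>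
    ('a \<Rightarrow> 'b) \<Rightarrow> 'a \<Rightarrow> 'b" where
  "lift0 M W0 X = (\<lambda>\<omega>. W0 (X \<omega>) (distr M borel X))"

definition lift :: "'a measure \<Rightarrow> ('b::euclidean_space \<Rightarrow> 'b measure \<Rightarrow> 'b \<Rightarrow> 'b) \<Rightarrow>
    ('a \<Rightarrow> 'b) \<Rightarrow> ('a \<Rightarrow> 'b) \<Rightarrow> 'a \<Rightarrow> 'b" where
  "lift M F X U = (\<lambda>\<omega>. F (X \<omega>) (distr M borel X) (U \<omega>))"

text \<open>Filtrations are indexed by all real times; only the times in $[0,T]$ matter below. A
  filtration on $[0,T]$ extends as a constant on either side.\<close>

definition sub_filtration :: "'a measure \<Rightarrow> (real \<Rightarrow> 'a measure) \<Rightarrow> bool" where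
  "sub_filtration M \<F> \<longleftrightarrow> filtration (space M) \<F> \<and> (\<forall>t. subalgebra M (\<F> t))"

definition brownian_motion :: "'a measure \<Rightarrow> (real \<Rightarrow> 'a measure) \<Rightarrow> real \<Rightarrow>
    (real \<Rightarrow> 'a \<Rightarrow> real^'n) \<Rightarrow> bool" where
  "brownian_motion M \<F> T B \<longleftrightarrow>
     (\<forall>t\<in>{0..T}. B t \<in> borel_measurable (\<F> t)) \<and>
     (AE \<omega> in M. B 0 \<omega> = 0) \<and>
     (AE \<omega> in M. continuous_on {0..T} (\<lambda>t. B t \<omega>)) \<and>
     (\<forall>s t. 0 \<le> s \<and> s < t \<and> t \<le> T \<longrightarrow>
        prob_space.indep_set M (sets (\<F> s))
          {(\<lambda>\<omega>. B t \<omega> - B s \<omega>) -` A \<inter> space M | A. A \<in> sets borel} \<and>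
        prob_space.indep_vars M (\<lambda>_. borel) (\<lambda>i \<omega>. (B t \<omega> - B s \<omega>) $ i) UNIV \<and>
        (\<forall>i. distributed M lborel (\<lambda>\<omega>. (B t \<omega> - B s \<omega>) $ i)
               (normal_density 0 (sqrt (t - s)))))"

definition time_interval :: "real \<Rightarrow> real \<Rightarrow> real measure" where
  "time_interval a b = restrict_space lborel {a..b}"

definition sq_int_process :: "'a measure \<Rightarrow> (real \<Rightarrow> 'a measure) \<Rightarrow> real \<Rightarrow>
    (real \<Rightarrow> 'a \<Rightarrow> 'b::euclidean_space) \<Rightarrow> bool" where
  "sq_int_process M \<F> T X \<longleftrightarrow>
     (\<forall>t\<in>{0..T}. X t \<in> borel_measurable (\<F> t)) \<and>
     (\<lambda>(t, \<omega>). X t \<omega>) \<in> L2_rv (time_interval 0 T \<Otimes>\<^sub>M M)"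

text \<open>The data $(m,\<tau>,\<xi>)$ encode the simple process
  $\sum_{k<m} \xi_k 1_{(\tau_k,\tau_{k+1}]}$ on $[a,b]$, with $\xi_k$ bounded and known at
  time $\tau_k$.\<close>

definition simple_process :: "'a measure \<Rightarrow> (real \<Rightarrow> 'a measure) \<Rightarrow> real \<Rightarrow> real \<Rightarrow>
    nat \<Rightarrow> (nat \<Rightarrow> real) \<Rightarrow> (nat \<Rightarrow> 'a \<Rightarrow> real^'n^'n) \<Rightarrow> bool" where
  "simple_process M \<F> a b m \<tau> \<xi> \<longleftrightarrow>
     \<tau> 0 = a \<and> \<tau> m = b \<and>
     (\<forall>k<m. \<tau> k \<le> \<tau> (Suc k) \<and> \<xi> k \<in> borel_measurable (\<F> (\<tau> k)) \<and>
            (\<exists>K. \<forall>\<omega>\<in>space M. norm (\<xi> k \<omega>) \<le> K))"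

definition simple_value :: "nat \<Rightarrow> (nat \<Rightarrow> real) \<Rightarrow> (nat \<Rightarrow> 'a \<Rightarrow> real^'n^'n) \<Rightarrow>
    real \<Rightarrow> 'a \<Rightarrow> real^'n^'n" where
  "simple_value m \<tau> \<xi> s \<omega> = (\<Sum>k<m. indicat_real {\<tau> k<..\<tau> (Suc k)} s *\<^sub>R \<xi> k \<omega>)"

definition simple_integral :: "(real \<Rightarrow> 'a \<Rightarrow> real^'n) \<Rightarrow> nat \<Rightarrow> (nat \<Rightarrow> real) \<Rightarrow>
    (nat \<Rightarrow> 'a \<Rightarrow> real^'n^'n) \<Rightarrow> 'a \<Rightarrow> real^'n" where
  "simple_integral B m \<tau> \<xi> \<omega> = (\<Sum>k<m. \<xi> k \<omega> *v (B (\<tau> (Suc k)) \<omega> - B (\<tau> k) \<omega>))"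

text \<open>The random variable $I$ is a version of $\int_a^b Z_s\,dB_s$: both limits are taken in
  mean square, of the integrands for $dt\otimes P$ and of the integrals for $P$. Like the
  Ito integral itself, $I$ is determined up to null sets only.\<close>

definition has_ito_integral :: "'a measure \<Rightarrow> (real \<Rightarrow> 'a measure) \<Rightarrow> (real \<Rightarrow> 'a \<Rightarrow> real^'n) \<Rightarrow>
    real \<Rightarrow> real \<Rightarrow> (real \<Rightarrow> 'a \<Rightarrow> real^'n^'n) \<Rightarrow> ('a \<Rightarrow> real^'n) \<Rightarrow> bool" where
  "has_ito_integral M \<F> B a b Z I \<longleftrightarrow> I \<in> L2_rv M \<and>
     (\<exists>m \<tau> \<xi>. (\<forall>n. simple_process M \<F> a b (m n) (\<tau> n) (\<xi> n)) \<and>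
        (\<lambda>n. \<integral>\<^sup>+p. ennreal ((norm (simple_value (m n) (\<tau> n) (\<xi> n) (fst p) (snd p)
                 - Z (fst p) (snd p)))\<^sup>2) \<partial>(time_interval a b \<Otimes>\<^sub>M M)) \<longlonglongrightarrow> 0 \<and>
        (\<lambda>n. \<integral>\<^sup>+\<omega>. ennreal ((norm (simple_integral B (m n) (\<tau> n) (\<xi> n) \<omega> - I \<omega>))\<^sup>2) \<partial>M)
          \<longlonglongrightarrow> 0)"

text \<open>The measurability and integrability of the two drifts on $[0,T]\times\Omega$ gives their
  pathwise Lebesgue integrals a meaning almost surely (the Bochner integral of the library is $0$
  on functions that are not integrable).\<close>

definition strong_solution :: "'a measure \<Rightarrow> (real \<Rightarrow> 'a measure) \<Rightarrow> (real \<Rightarrow> 'a \<Rightarrow> real^'n) \<Rightarrow>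
    real \<Rightarrow> real \<Rightarrow>
    (real^'n \<Rightarrow> (real^'n) measure \<Rightarrow> real^'n) \<Rightarrow>
    (real^'n \<Rightarrow> (real^'n) measure \<Rightarrow> real^'n \<Rightarrow> real^'n) \<Rightarrow>
    (real^'n \<Rightarrow> (real^'n) measure \<Rightarrow> real^'n \<Rightarrow> real^'n) \<Rightarrow>
    ('a \<Rightarrow> real^'n) \<Rightarrow>
    (real \<Rightarrow> 'a \<Rightarrow> real^'n) \<Rightarrow> (real \<Rightarrow> 'a \<Rightarrow> real^'n) \<Rightarrow> (real \<Rightarrow> 'a \<Rightarrow> real^'n^'n) \<Rightarrow> bool" where
  "strong_solution M \<F> B T \<sigma> W0 F G X0 X W Z \<longleftrightarrow>
     sq_int_process M \<F> T X \<and> sq_int_process M \<F> T W \<and> sq_int_process M \<F> T Z \<and>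
     (\<forall>t\<in>{0..T}. X t \<in> L2_rv M \<and> W t \<in> L2_rv M) \<and>
     integrable (time_interval 0 T \<Otimes>\<^sub>M M) (\<lambda>(s, \<omega>). lift M F (X s) (W s) \<omega>) \<and>
     integrable (time_interval 0 T \<Otimes>\<^sub>M M) (\<lambda>(s, \<omega>). lift M G (X s) (W s) \<omega>) \<and>
     (\<forall>t\<in>{0..T}. AE \<omega> in M.
        X t \<omega> = X0 \<omega> - (LINT s:{0..t}|lborel. lift M F (X s) (W s) \<omega>) + \<sigma> *\<^sub>R B t \<omega>) \<and>
     (\<forall>t\<in>{0..T}. \<exists>I. has_ito_integral M \<F> B t T Z I \<and>
        (AE \<omega> in M. W t \<omega> = lift0 M W0 (X T) \<omega>
            + (LINT s:{t..T}|lborel. lift M G (X s) (W s) \<omega>) - I \<omega>))"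

end

theory Submission
  imports Defs
begin

text \<open>
  Let $x = X - Y$ and $V = W^x - W^y$, let $f$ and $g$ be the differences of the lifted drifts $F$ and $G$
  along the two solutions, $h$ the difference of the terminal values, and $x_0 = X_0 - Y_0$. Both forward
  equations contain the same noise, so that
  \[ x_t = x_0 - \int_0^t f_s\,ds, \qquad V_t + I_t = h + \int_t^T g_s\,ds, \]
  where $I_t$ is an Ito integral over $[t,T]$. It is orthogonal in $L^2$ to every square integrable
  variable known at time $t$ (\<open>ito_integral_orthogonal\<close>): this holds for simple integrands by
  independence of the increments of $B$, and passes to the limit. Stochastic calculus is thereby
  reduced to geometry in the Hilbert space $L^2$ and to Fubini's theorem for kernels such as
  $\langle g_s, f_r\rangle$, which give (\<open>duality\<close>, \<open>forward_energy\<close>, \<open>backward_energy\<close>)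
  \[ \langle V_0, x_0\rangle = \langle h, x_T\rangle + \int_0^T (\langle g_s, x_s\rangle + \langle f_s, V_s\rangle)\,ds, \]
  \[ \|x_t\|^2 = \|x_0\|^2 - 2\int_0^t \langle f_s, x_s\rangle\,ds, \qquad
     \|V_t\|^2 \le \|h\|^2 + 2\int_t^T \langle g_s, V_s\rangle\,ds. \]

  Put $S = \|V_0\| \|x_0\| + \|x_0\|^2$. Since $\langle h, x_T\rangle$ and the integrand of the first identity
  are nonnegative, strong monotonicity gives
  $\alpha\int_0^t \|V_s\|^2\,ds \le S + L\int_0^t \|x_s\|^2\,ds$ for every $t$. With the lower bound on
  $\langle f, x\rangle$, the second identity becomes a Gronwall inequality, so that $\|x_t\|^2$ and
  $\int_0^T \|V_s\|^2\,ds$ are at most a constant times $S$. The third relation then bounds $\|V_t\|^2$ by a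
  constant times $\max(S, S^\gamma)$ (\<open>stability_estimates\<close>).

  At $t = 0$ this is an inequality for the unknown $\|V_0\|$: up to constants,
  $\|V_0\|^2 \le (\|V_0\| \|x_0\|)^\gamma$ in the critical regime, that is
  $\|V_0\| \le \|x_0\|^{\gamma/(2-\gamma)}$. Hence $S$ is of order $\|x_0\|^{2/(2-\gamma)}$, and the two exponents of
  the theorem are read off from the bounds on $\|x_t\|$ and $\|V_t\|$ (\<open>hoelder_closure\<close>).
\<close>

section \<open>Random variables in $L^2$\<close>

lemma L2_rv_measurable [measurable_dest]: "X \<in> L2_rv M \<Longrightarrow> X \<in> borel_measurable M"
  by (simp add: L2_rv_def)

lemma L2_rv_norm_squared_integrable: "X \<in> L2_rv M \<Longrightarrow> integrable M (\<lambda>\<omega>. (norm (X \<omega>))\<^sup>2)"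
  by (simp add: L2_rv_def)

lemma L2_rvI_bound:
  assumes "X \<in> borel_measurable M" "integrable M u"
    and "AE \<omega> in M. (norm (X \<omega>))\<^sup>2 \<le> u \<omega>"
  shows "X \<in> L2_rv M"
proof -
  have "integrable M (\<lambda>\<omega>. (norm (X \<omega>))\<^sup>2)"
    by (rule Bochner_Integration.integrable_bound[OF assms(2)])
       (use assms(1,3) in \<open>auto elim!: eventually_mono intro: order_trans[OF _ abs_ge_self]\<close>)
  with assms(1) show ?thesis by (simp add: L2_rv_def)
qed

lemma norm_add_squared_le: "(norm (a + b))\<^sup>2 \<le> 2 * (norm a)\<^sup>2 + 2 * (norm b)\<^sup>2"
  for a b :: "'b::real_normed_vector"
proof -
  have "(norm (a + b))\<^sup>2 \<le> (norm a + norm b)\<^sup>2"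
    by (intro power_mono norm_triangle_ineq) auto
  also have "\<dots> \<le> 2 * (norm a)\<^sup>2 + 2 * (norm b)\<^sup>2"
    using sum_squares_ge_zero[of "norm a - norm b" 0] by (simp add: power2_eq_square algebra_simps)
  finally show ?thesis .
qed

lemma L2_rv_add [intro]:
  assumes "X \<in> L2_rv M" "Y \<in> L2_rv M"
  shows "(\<lambda>\<omega>. X \<omega> + Y \<omega>) \<in> L2_rv M"
proof (rule L2_rvI_bound)
  show "(\<lambda>\<omega>. X \<omega> + Y \<omega>) \<in> borel_measurable M"
    using assms by measurable
  show "integrable M (\<lambda>\<omega>. 2 * (norm (X \<omega>))\<^sup>2 + 2 * (norm (Y \<omega>))\<^sup>2)"
    using assms by (simp add: L2_rv_norm_squared_integrable)
qed (auto intro!: AE_I2 norm_add_squared_le)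

lemma L2_rv_scaleR [intro]:
  assumes "X \<in> L2_rv M"
  shows "(\<lambda>\<omega>. c *\<^sub>R X \<omega>) \<in> L2_rv M"
  using assms by (auto simp: L2_rv_def power_mult_distrib)

lemma L2_rv_diff [intro]:
  assumes "X \<in> L2_rv M" "Y \<in> L2_rv M"
  shows "(\<lambda>\<omega>. X \<omega> - Y \<omega>) \<in> L2_rv M"
  using L2_rv_add[OF assms(1) L2_rv_scaleR[OF assms(2), of "-1"]] by simp

lemma L2_inner_integrable:
  assumes "X \<in> L2_rv M" "Y \<in> L2_rv M"
  shows "integrable M (\<lambda>\<omega>. X \<omega> \<bullet> Y \<omega>)"
proof (rule Bochner_Integration.integrable_bound)
  show "integrable M (\<lambda>\<omega>. (norm (X \<omega>))\<^sup>2 + (norm (Y \<omega>))\<^sup>2)"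
    using assms by (simp add: L2_rv_norm_squared_integrable)
  show "(\<lambda>\<omega>. X \<omega> \<bullet> Y \<omega>) \<in> borel_measurable M"
    using assms by measurable
  have "\<bar>a \<bullet> b\<bar> \<le> (norm a)\<^sup>2 + (norm b)\<^sup>2" for a b :: 'b
  proof -
    have "\<bar>a \<bullet> b\<bar> \<le> norm a * norm b" by (rule Cauchy_Schwarz_ineq2)
    also have "\<dots> \<le> (norm a)\<^sup>2 + (norm b)\<^sup>2"
      using sum_squares_bound[of "norm a" "norm b"]
        mult_nonneg_nonneg[OF norm_ge_zero[of a] norm_ge_zero[of b]] by linarith
    finally show ?thesis .
  qed
  then show "AE \<omega> in M. norm (X \<omega> \<bullet> Y \<omega>) \<le> norm ((norm (X \<omega>))\<^sup>2 + (norm (Y \<omega>))\<^sup>2)"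
    by (intro AE_I2) simp
qed

lemma L2_inner_commute: "L2_inner M X Y = L2_inner M Y X"
  by (simp add: L2_inner_def inner_commute)

lemma L2_inner_add_left:
  assumes "X \<in> L2_rv M" "Y \<in> L2_rv M" "C \<in> L2_rv M"
  shows "L2_inner M (\<lambda>\<omega>. X \<omega> + Y \<omega>) C = L2_inner M X C + L2_inner M Y C"
  using assms by (simp add: L2_inner_def inner_add_left L2_inner_integrable)

lemma L2_inner_diff_left:
  assumes "X \<in> L2_rv M" "Y \<in> L2_rv M" "C \<in> L2_rv M"
  shows "L2_inner M (\<lambda>\<omega>. X \<omega> - Y \<omega>) C = L2_inner M X C - L2_inner M Y C"
  using assms by (simp add: L2_inner_def inner_diff_left L2_inner_integrable)

lemma L2_inner_scaleR_left: "L2_inner M (\<lambda>\<omega>. c *\<^sub>R X \<omega>) Y = c * L2_inner M X Y"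
  by (simp add: L2_inner_def)

lemma L2_inner_add_right:
  assumes "X \<in> L2_rv M" "Y \<in> L2_rv M" "C \<in> L2_rv M"
  shows "L2_inner M C (\<lambda>\<omega>. X \<omega> + Y \<omega>) = L2_inner M C X + L2_inner M C Y"
  using L2_inner_add_left[OF assms] by (simp add: L2_inner_commute)

lemma L2_inner_diff_right:
  assumes "X \<in> L2_rv M" "Y \<in> L2_rv M" "C \<in> L2_rv M"
  shows "L2_inner M C (\<lambda>\<omega>. X \<omega> - Y \<omega>) = L2_inner M C X - L2_inner M C Y"
  using L2_inner_diff_left[OF assms] by (simp add: L2_inner_commute)

lemma L2_inner_cong_AE:
  assumes "X \<in> L2_rv M" "X' \<in> L2_rv M" "Y \<in> L2_rv M" "Y' \<in> L2_rv M"
    and "AE \<omega> in M. X \<omega> = X' \<omega>" "AE \<omega> in M. Y \<omega> = Y' \<omega>"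
  shows "L2_inner M X Y = L2_inner M X' Y'"
  unfolding L2_inner_def
  by (rule integral_cong_AE)
     (use assms in \<open>auto intro!: borel_measurable_inner L2_rv_measurable\<close>)

lemma L2_inner_self: "L2_inner M X X = (\<integral>\<omega>. (norm (X \<omega>))\<^sup>2 \<partial>M)"
  by (simp add: L2_inner_def dot_square_norm)

lemma L2_inner_self_nonneg [simp]: "0 \<le> L2_inner M X X"
  by (simp add: L2_inner_self)

lemma L2_nrm_nonneg [simp]: "0 \<le> L2_nrm M X"
  by (simp add: L2_nrm_def)

lemma L2_nrm_squared: "(L2_nrm M X)\<^sup>2 = L2_inner M X X"
  by (simp add: L2_nrm_def)

text \<open>The form $\|bX - aY\|^2$ is nonnegative for all real $a$, $b$; the choice $a = \|X\|$,
  $b = \|Y\|$ gives the inequality as soon as both norms are positive.\<close>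

lemma L2_Cauchy_Schwarz:
  assumes X: "X \<in> L2_rv M" and Y: "Y \<in> L2_rv M"
  shows "L2_inner M X Y \<le> L2_nrm M X * L2_nrm M Y"
proof -
  have quad: "0 \<le> b\<^sup>2 * L2_inner M X X - 2 * a * b * L2_inner M X Y + a\<^sup>2 * L2_inner M Y Y" for a b
  proof -
    have "0 \<le> L2_inner M (\<lambda>\<omega>. b *\<^sub>R X \<omega> - a *\<^sub>R Y \<omega>) (\<lambda>\<omega>. b *\<^sub>R X \<omega> - a *\<^sub>R Y \<omega>)" by simp
    also have "\<dots> = (\<integral>\<omega>. b\<^sup>2 * (X \<omega> \<bullet> X \<omega>) - 2 * a * b * (X \<omega> \<bullet> Y \<omega>) + a\<^sup>2 * (Y \<omega> \<bullet> Y \<omega>) \<partial>M)"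
      unfolding L2_inner_def
      by (intro Bochner_Integration.integral_cong)
         (auto simp: inner_diff_left inner_diff_right power2_eq_square inner_commute algebra_simps)
    finally show ?thesis
      using X Y by (simp add: L2_inner_def L2_inner_integrable)
  qed
  define p q where "p = L2_nrm M X" and "q = L2_nrm M Y"
  have pq: "L2_inner M X X = p\<^sup>2" "L2_inner M Y Y = q\<^sup>2" "0 \<le> p" "0 \<le> q"
    by (auto simp: p_def q_def L2_nrm_squared)
  let ?e = "L2_inner M X Y"
  show ?thesis
  proof (cases "p = 0 \<or> q = 0")
    case False
    with pq have "0 < 2 * p * q" by simp
    moreover have "2 * p * q * ?e \<le> 2 * p * q * (p * q)"
      using quad[where a = p and b = q] pq by (simp add: power2_eq_square algebra_simps)
    ultimately show ?thesis
      by (simp add: p_def q_def mult_le_cancel_left)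
  next
    case True
    \<comment> \<open>If one norm vanishes, the quadratic form is affine in one of its two arguments.\<close>
    have "?e \<le> 0"
    proof (rule ccontr)
      assume "\<not> ?e \<le> 0"
      then have e: "?e > 0" by simp
      have False if "q = 0"
      proof -
        have "p\<^sup>2 - 2 * (p\<^sup>2 + 1) = - p\<^sup>2 - 2" by simp
        then show False
          using quad[where b = 1 and a = "(p\<^sup>2 + 1) / ?e"] e pq that zero_le_power2[of p] by simp
      qed
      moreover have False if "p = 0"
      proof -
        have "q\<^sup>2 - 2 * (q\<^sup>2 + 1) = - q\<^sup>2 - 2" by simp
        then show False
          using quad[where a = 1 and b = "(q\<^sup>2 + 1) / ?e"] e pq that zero_le_power2[of q] by simp
      qed
      ultimately show False using True by blast
    qed
    with True show ?thesis by (auto simp: p_def q_def)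
  qed
qed

lemma L2_Cauchy_Schwarz_abs:
  assumes "X \<in> L2_rv M" "Y \<in> L2_rv M"
  shows "\<bar>L2_inner M X Y\<bar> \<le> L2_nrm M X * L2_nrm M Y"
proof -
  have "L2_nrm M (\<lambda>\<omega>. (-1) *\<^sub>R X \<omega>) = L2_nrm M X"
    by (simp add: L2_nrm_def L2_inner_def)
  then have "- L2_inner M X Y \<le> L2_nrm M X * L2_nrm M Y"
    using L2_Cauchy_Schwarz[OF L2_rv_scaleR[OF assms(1), of "-1"] assms(2)]
      L2_inner_scaleR_left[of M "-1" X Y] by simp
  with L2_Cauchy_Schwarz[OF assms] show ?thesis by linarith
qed

section \<open>Square integrable processes\<close>

text \<open>Square integrability on the product yields $g_s \in L^2$ for almost every $s$. It is asked for at
  every $s$, so that the kernel $\langle f_s, g_r\rangle$ is a genuine inner product at all times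
  and identities between kernels hold pointwise.\<close>

definition L2_process :: "'s measure \<Rightarrow> 'a measure \<Rightarrow> ('s \<Rightarrow> 'a \<Rightarrow> 'b::euclidean_space) \<Rightarrow> bool" where
  "L2_process N M g \<longleftrightarrow> (\<lambda>(s, \<omega>). g s \<omega>) \<in> L2_rv (N \<Otimes>\<^sub>M M) \<and> (\<forall>s\<in>space N. g s \<in> L2_rv M)"

lemma L2_processD:
  assumes "L2_process N M g"
  shows "case_prod g \<in> L2_rv (N \<Otimes>\<^sub>M M)" "\<And>s. s \<in> space N \<Longrightarrow> g s \<in> L2_rv M"
  using assms by (auto simp: L2_process_def)

lemma L2_process_diff:
  assumes "L2_process N M f" "L2_process N M g"
  shows "L2_process N M (\<lambda>s \<omega>. f s \<omega> - g s \<omega>)"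
proof -
  have "(\<lambda>p. case_prod f p - case_prod g p) \<in> L2_rv (N \<Otimes>\<^sub>M M)"
    using assms by (intro L2_rv_diff L2_processD)
  with assms show ?thesis
    by (auto simp: L2_process_def split_beta' intro: L2_rv_diff)
qed

lemma (in finite_measure) L2_rv_const: "(\<lambda>_. c) \<in> L2_rv M"
  by (simp add: L2_rv_def)

lemma (in finite_measure) L2_rv_integrable:
  assumes "X \<in> L2_rv M"
  shows "integrable M X"
proof (rule Bochner_Integration.integrable_bound)
  show "integrable M (\<lambda>\<omega>. 1 + (norm (X \<omega>))\<^sup>2)"
    using assms by (simp add: L2_rv_norm_squared_integrable)
  have "norm a \<le> 1 + (norm a)\<^sup>2" for a :: 'b
    using sum_squares_bound[of 1 "norm a"] norm_ge_zero[of a] unfolding power2_eq_square by linarith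
  then show "AE \<omega> in M. norm (X \<omega>) \<le> norm (1 + (norm (X \<omega>))\<^sup>2)" by simp
qed (use assms in measurable)

text \<open>Cauchy-Schwarz against the constant function one. A function that is not integrable over $A$ has
  integral zero by convention, which is consistent with the bound.\<close>

lemma (in finite_measure) norm_integral_squared_le:
  assumes X: "X \<in> L2_rv M"
  shows "(norm (LINT \<omega>:A|M. X \<omega>))\<^sup>2 \<le> measure M (space M) * (\<integral>\<omega>. (norm (X \<omega>))\<^sup>2 \<partial>M)"
proof (cases "set_integrable M A X")
  case False
  then show ?thesis
    by (simp add: set_integrable_def set_lebesgue_integral_def not_integrable_integral_eq)
next
  case True
  have nX: "(\<lambda>\<omega>. norm (X \<omega>)) \<in> L2_rv M"
    using X by (auto simp: L2_rv_def)
  have "norm (LINT \<omega>:A|M. X \<omega>) \<le> (\<integral>\<omega>. norm (indicat_real A \<omega> *\<^sub>R X \<omega>) \<partial>M)"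
    unfolding set_lebesgue_integral_def by (rule integral_norm_bound)
  also have "\<dots> \<le> L2_inner M (\<lambda>\<omega>. norm (X \<omega>)) (\<lambda>_. 1::real)"
    unfolding L2_inner_def
  proof (rule integral_mono)
    show "integrable M (\<lambda>\<omega>. norm (indicat_real A \<omega> *\<^sub>R X \<omega>))"
      using True unfolding set_integrable_def by (rule integrable_norm)
    show "integrable M (\<lambda>\<omega>. norm (X \<omega>) \<bullet> 1)"
      using L2_rv_integrable[OF X] by simp
  qed (auto simp: indicator_def)
  also have "\<dots> \<le> L2_nrm M (\<lambda>\<omega>. norm (X \<omega>)) * L2_nrm M (\<lambda>_. 1::real)"
    by (rule L2_Cauchy_Schwarz[OF nX L2_rv_const])
  finally have "(norm (LINT \<omega>:A|M. X \<omega>))\<^sup>2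
      \<le> (L2_nrm M (\<lambda>\<omega>. norm (X \<omega>)) * L2_nrm M (\<lambda>_. 1::real))\<^sup>2"
    by (intro power_mono) auto
  then show ?thesis
    by (simp add: power_mult_distrib L2_nrm_squared L2_inner_self mult.commute)
qed

locale time_randomness = N: finite_measure N + M: prob_space M
  for N :: "'s measure" and M :: "'a measure"
begin

sublocale pair_sigma_finite N M ..
sublocale NM: finite_measure "N \<Otimes>\<^sub>M M"
  by (rule finite_measure_pair_measure) unfold_locales
sublocale NN: pair_sigma_finite N N ..

lemma L2_rv_time_independent:
  assumes "c \<in> L2_rv M"
  shows "(\<lambda>(s, \<omega>). c \<omega>) \<in> L2_rv (N \<Otimes>\<^sub>M M)"
proof -
  have [measurable]: "c \<in> borel_measurable M" using assms by measurable
  have "integrable (N \<Otimes>\<^sub>M M) (\<lambda>p. (norm (c (snd p)))\<^sup>2)"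
    by (rule Fubini_integrable) (use assms in \<open>auto intro: L2_rv_norm_squared_integrable\<close>)
  then show ?thesis by (simp add: L2_rv_def split_beta')
qed

context
  fixes g :: "'s \<Rightarrow> 'a \<Rightarrow> 'b::euclidean_space"
  assumes g: "L2_process N M g"
begin

lemma L2_process_measurable: "case_prod g \<in> borel_measurable (N \<Otimes>\<^sub>M M)"
  using L2_processD(1)[OF g] by measurable

lemma L2_process_norm_integrable: "integrable N (\<lambda>s. L2_inner M (g s) (g s))"
  using integrable_fst'[OF L2_rv_norm_squared_integrable[OF L2_processD(1)[OF g]]]
  by (simp add: L2_inner_self)

lemma L2_process_AE_path: "AE \<omega> in M. (\<lambda>s. g s \<omega>) \<in> L2_rv N"
proof -
  note [measurable] = L2_process_measurable
  have "AE \<omega> in M. integrable N (\<lambda>s. (norm (g s \<omega>))\<^sup>2)"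
    by (rule AE_integrable_snd)
       (use L2_rv_norm_squared_integrable[OF L2_processD(1)[OF g]] in \<open>simp add: split_beta'\<close>)
  with AE_space show ?thesis
    by eventually_elim (auto simp: L2_rv_def)
qed

lemma L2_process_integral:
  assumes A [measurable]: "Measurable.pred N (\<lambda>s. s \<in> A)"
  shows "(\<lambda>\<omega>. LINT s:A|N. g s \<omega>) \<in> L2_rv M"
proof (rule L2_rvI_bound)
  note [measurable] = L2_process_measurable
  show "(\<lambda>\<omega>. LINT s:A|N. g s \<omega>) \<in> borel_measurable M"
    unfolding set_lebesgue_integral_def by measurable
  have "integrable (N \<Otimes>\<^sub>M M) (\<lambda>(s, \<omega>). (norm (g s \<omega>))\<^sup>2)"
    using L2_rv_norm_squared_integrable[OF L2_processD(1)[OF g]] by (simp add: split_beta')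
  from integrable_snd[OF this]
  show "integrable M (\<lambda>\<omega>. measure N (space N) * (\<integral>s. (norm (g s \<omega>))\<^sup>2 \<partial>N))" by simp
  show "AE \<omega> in M. (norm (LINT s:A|N. g s \<omega>))\<^sup>2
      \<le> measure N (space N) * (\<integral>s. (norm (g s \<omega>))\<^sup>2 \<partial>N)"
    using L2_process_AE_path by eventually_elim (rule N.norm_integral_squared_le)
qed

text \<open>The pathwise time integral is also the weak integral in $L^2$: testing it against a random variable
  and integrating the tested process in time commute. This is how all random objects are replaced by
  deterministic functions of time.\<close>

lemma
  assumes A [measurable]: "Measurable.pred N (\<lambda>s. s \<in> A)" and c: "c \<in> L2_rv M"
  shows inner_process_integrable: "set_integrable N A (\<lambda>s. L2_inner M c (g s))"
    and inner_integral_process: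
      "L2_inner M c (\<lambda>\<omega>. LINT s:A|N. g s \<omega>) = (LINT s:A|N. L2_inner M c (g s))"
proof -
  note [measurable] = L2_process_measurable
  have "integrable (N \<Otimes>\<^sub>M M) (\<lambda>p. (case p of (s, \<omega>) \<Rightarrow> c \<omega>) \<bullet> case_prod g p)"
    by (rule L2_inner_integrable[OF L2_rv_time_independent[OF c] L2_processD(1)[OF g]])
  then have int: "integrable (N \<Otimes>\<^sub>M M) (\<lambda>(s, \<omega>). indicat_real A s *\<^sub>R (c \<omega> \<bullet> g s \<omega>))"
  proof (rule Bochner_Integration.integrable_bound)
    have [measurable]: "c \<in> borel_measurable M" using c by measurable
    show "(\<lambda>(s, \<omega>). indicat_real A s *\<^sub>R (c \<omega> \<bullet> g s \<omega>)) \<in> borel_measurable (N \<Otimes>\<^sub>M M)"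
      by measurable
  qed (auto simp: indicator_def)
  have eq: "(\<integral>\<omega>. indicat_real A s *\<^sub>R (c \<omega> \<bullet> g s \<omega>) \<partial>M) = indicat_real A s *\<^sub>R L2_inner M c (g s)" for s
    by (simp add: L2_inner_def)
  show "set_integrable N A (\<lambda>s. L2_inner M c (g s))"
    using integrable_fst[OF int] unfolding eq set_integrable_def .
  have "AE \<omega> in M. c \<omega> \<bullet> (LINT s:A|N. g s \<omega>) = (\<integral>s. indicat_real A s *\<^sub>R (c \<omega> \<bullet> g s \<omega>) \<partial>N)"
    using L2_process_AE_path
  proof eventually_elim
    fix \<omega> assume "(\<lambda>s. g s \<omega>) \<in> L2_rv N"
    then have "integrable N (\<lambda>s. g s \<omega>)" by (rule N.L2_rv_integrable)
    moreover from this have [measurable]: "(\<lambda>s. g s \<omega>) \<in> borel_measurable N" by measurable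
    have "(\<lambda>s. indicat_real A s *\<^sub>R g s \<omega>) \<in> borel_measurable N" by measurable
    ultimately have "integrable N (\<lambda>s. indicat_real A s *\<^sub>R g s \<omega>)"
      by (rule Bochner_Integration.integrable_bound) (auto simp: indicator_def)
    then show "c \<omega> \<bullet> (LINT s:A|N. g s \<omega>) = (\<integral>s. indicat_real A s *\<^sub>R (c \<omega> \<bullet> g s \<omega>) \<partial>N)"
      by (simp add: set_lebesgue_integral_def flip: integral_inner_right)
  qed
  moreover have [measurable]: "c \<in> borel_measurable M" using c by measurable
  moreover note L2_rv_measurable[OF L2_process_integral[OF A], measurable]
    and measurable_pair_swap[OF L2_process_measurable]
  ultimately have "L2_inner M c (\<lambda>\<omega>. LINT s:A|N. g s \<omega>)
      = (\<integral>\<omega>. (\<integral>s. indicat_real A s *\<^sub>R (c \<omega> \<bullet> g s \<omega>) \<partial>N) \<partial>M)"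
    unfolding L2_inner_def
    by (intro integral_cong_AE) measurable
  also have "\<dots> = (LINT s:A|N. L2_inner M c (g s))"
    unfolding Fubini_integral[OF int] eq set_lebesgue_integral_def ..
  finally show "L2_inner M c (\<lambda>\<omega>. LINT s:A|N. g s \<omega>) = (LINT s:A|N. L2_inner M c (g s))" .
qed

end

text \<open>By Cauchy-Schwarz the kernel is dominated by $\|f_s\|^2 + \|g_r\|^2$, in which each summand depends
  on one time only.\<close>

lemma inner_kernel_integrable:
  assumes f: "L2_process N M f" and g: "L2_process N M g"
  shows "integrable (N \<Otimes>\<^sub>M N) (\<lambda>(s, r). L2_inner M (f s) (g r))"
proof (rule Bochner_Integration.integrable_bound)
  note [measurable] = L2_process_measurable[OF f] L2_process_measurable[OF g]
  show "(\<lambda>(s, r). L2_inner M (f s) (g r)) \<in> borel_measurable (N \<Otimes>\<^sub>M N)"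
    unfolding L2_inner_def split_beta' by measurable
  note [measurable] = borel_measurable_integrable[OF L2_process_norm_integrable[OF f]]
    borel_measurable_integrable[OF L2_process_norm_integrable[OF g]]
  have "integrable (N \<Otimes>\<^sub>M N) (\<lambda>p. L2_inner M (f (fst p)) (f (fst p)))"
    by (rule NN.Fubini_integrable)
       (use L2_process_norm_integrable[OF f] in \<open>auto simp: measurable_split_conv\<close>)
  moreover have "integrable (N \<Otimes>\<^sub>M N) (\<lambda>p. L2_inner M (g (snd p)) (g (snd p)))"
    by (rule NN.Fubini_integrable)
       (use L2_process_norm_integrable[OF g] in \<open>auto simp: measurable_split_conv\<close>)
  ultimately show "integrable (N \<Otimes>\<^sub>M N)
      (\<lambda>p. L2_inner M (f (fst p)) (f (fst p)) + L2_inner M (g (snd p)) (g (snd p)))" by simp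
  show "AE p in N \<Otimes>\<^sub>M N. norm (case p of (s, r) \<Rightarrow> L2_inner M (f s) (g r))
      \<le> norm (L2_inner M (f (fst p)) (f (fst p)) + L2_inner M (g (snd p)) (g (snd p)))"
  proof (rule AE_I2)
    fix p assume "p \<in> space (N \<Otimes>\<^sub>M N)"
    then obtain s r where p: "p = (s, r)" and sr: "s \<in> space N" "r \<in> space N"
      by (auto simp: space_pair_measure)
    have "\<bar>L2_inner M (f s) (g r)\<bar> \<le> L2_nrm M (f s) * L2_nrm M (g r)"
      using sr f g by (intro L2_Cauchy_Schwarz_abs L2_processD(2))
    also have "\<dots> \<le> (L2_nrm M (f s))\<^sup>2 + (L2_nrm M (g r))\<^sup>2"
      using sum_squares_bound[of "L2_nrm M (f s)" "L2_nrm M (g r)"]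
        mult_nonneg_nonneg[OF L2_nrm_nonneg[of M "f s"] L2_nrm_nonneg[of M "g r"]] by linarith
    finally show "norm (case p of (s, r) \<Rightarrow> L2_inner M (f s) (g r))
      \<le> norm (L2_inner M (f (fst p)) (f (fst p)) + L2_inner M (g (snd p)) (g (snd p)))"
      by (simp add: p L2_nrm_squared)
  qed
qed

end

section \<open>Double integrals in time\<close>

lemma space_time_interval [simp]: "space (time_interval a b) = {a..b}"
  by (simp add: time_interval_def)

lemma finite_measure_time_interval: "finite_measure (time_interval a b)"
  by (rule finite_measureI) (simp add: time_interval_def emeasure_restrict_space emeasure_lborel_Icc_eq)

lemma measurable_pred_time_interval:
  assumes "A \<in> sets borel"
  shows "Measurable.pred (time_interval a b) (\<lambda>s. s \<in> A)"
  unfolding time_interval_def by (rule measurable_restrict_space1) (use assms in simp)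

lemma measurable_time_interval_ident: "(\<lambda>s. s) \<in> borel_measurable (time_interval a b)"
  unfolding time_interval_def by (rule measurable_restrict_space1) simp

lemma AE_time_interval_neq: "AE r in time_interval a b. r \<noteq> s"
  unfolding time_interval_def
  by (subst AE_restrict_space_iff) (auto intro: AE_mp[OF AE_lborel_singleton[of s]])

lemma set_integral_time_interval:
  fixes f :: "real \<Rightarrow> 'b::{banach, second_countable_topology}"
  assumes "A \<subseteq> {a..b}"
  shows "(LINT s:A|time_interval a b. f s) = (LINT s:A|lborel. f s)"
    "set_integrable (time_interval a b) A f \<longleftrightarrow> set_integrable lborel A f"
proof -
  have *: "indicat_real {a..b} s *\<^sub>R indicat_real A s *\<^sub>R f s = indicat_real A s *\<^sub>R f s" for s
    using assms by (auto simp: indicator_def)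
  show "(LINT s:A|time_interval a b. f s) = (LINT s:A|lborel. f s)"
    unfolding set_lebesgue_integral_def time_interval_def
    by (subst integral_restrict_space) (simp_all only: *, simp_all)
  show "set_integrable (time_interval a b) A f \<longleftrightarrow> set_integrable lborel A f"
    unfolding set_integrable_def time_interval_def
    by (subst integrable_restrict_space) (simp_all only: *, simp_all)
qed

lemma set_integrable_eq:
  assumes "set_integrable M A u" and eq: "\<And>s. s \<in> A \<Longrightarrow> u s = v s"
  shows "set_integrable M A v"
proof -
  have "indicat_real A s *\<^sub>R u s = indicat_real A s *\<^sub>R v s" for s
    using eq by (auto simp: indicator_def)
  with assms(1) show ?thesis by (simp only: set_integrable_def)
qed

lemma set_integral_eq:
  assumes eq: "\<And>s. s \<in> A \<Longrightarrow> u s = v s"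
  shows "(LINT s:A|M. u s) = (LINT s:A|M. v s)"
proof -
  have "indicat_real A s *\<^sub>R u s = indicat_real A s *\<^sub>R v s" for s
    using eq by (auto simp: indicator_def)
  then show ?thesis by (simp only: set_lebesgue_integral_def)
qed

locale random_evolution = time_randomness "time_interval 0 T" M
  for T :: real and M :: "'a measure"
begin

abbreviation "N \<equiv> time_interval 0 T"

context
  fixes k :: "real \<Rightarrow> real \<Rightarrow> real" and S S' :: "real set"
  assumes k: "integrable (N \<Otimes>\<^sub>M N) (case_prod k)"
    and S [measurable]: "S \<in> sets borel" and S' [measurable]: "S' \<in> sets borel"
begin

lemma integrable_triangle_pair:
  "integrable (N \<Otimes>\<^sub>M N)
     (\<lambda>(s, r). indicat_real S s *\<^sub>R indicat_real (S' \<inter> {..s}) r *\<^sub>R k s r)"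
proof (rule Bochner_Integration.integrable_bound[OF k])
  note [measurable] = measurable_time_interval_ident
    measurable_pred_time_interval[OF S] measurable_pred_time_interval[OF S']
  have [measurable]: "case_prod k \<in> borel_measurable (N \<Otimes>\<^sub>M N)" using k by simp
  have "(\<lambda>(s, r). indicat_real S s *\<^sub>R indicat_real (S' \<inter> {..s}) r *\<^sub>R k s r)
      = (\<lambda>(s, r). if s \<in> S \<and> r \<in> S' \<and> r \<le> s then k s r else 0)"
    by (auto simp: fun_eq_iff indicator_def)
  also have "\<dots> \<in> borel_measurable (N \<Otimes>\<^sub>M N)" by measurable
  finally show "(\<lambda>(s, r). indicat_real S s *\<^sub>R indicat_real (S' \<inter> {..s}) r *\<^sub>R k s r)
      \<in> borel_measurable (N \<Otimes>\<^sub>M N)" .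
qed (auto simp: indicator_def)

lemma set_integrable_triangle_le: "set_integrable N S (\<lambda>s. LINT r:S'\<inter>{..s}|N. k s r)"
  using NN.integrable_fst[OF integrable_triangle_pair]
  by (simp add: set_integrable_def set_lebesgue_integral_def)

lemma triangle_swap_eq:
  "indicat_real S s *\<^sub>R indicat_real (S' \<inter> {..s}) r *\<^sub>R k s r
     = indicat_real S' r *\<^sub>R indicat_real (S \<inter> {r..}) s *\<^sub>R k s r"
  by (auto simp: indicator_def)

lemma set_integrable_triangle_ge: "set_integrable N S' (\<lambda>r. LINT s:S\<inter>{r..}|N. k s r)"
  using NN.integrable_snd[OF integrable_triangle_pair]
  by (simp only: triangle_swap_eq) (simp add: set_integrable_def set_lebesgue_integral_def)

text \<open>Fubini's theorem on the triangle $r \le s$, seen from either side.\<close>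

lemma triangle_swap:
  "(LINT s:S|N. LINT r:S'\<inter>{..s}|N. k s r) = (LINT r:S'|N. LINT s:S\<inter>{r..}|N. k s r)"
proof -
  have "(LINT s:S|N. LINT r:S'\<inter>{..s}|N. k s r)
      = (\<integral>s. (\<integral>r. indicat_real S s *\<^sub>R indicat_real (S' \<inter> {..s}) r *\<^sub>R k s r \<partial>N) \<partial>N)"
    by (simp add: set_lebesgue_integral_def)
  also have "\<dots> = (\<integral>r. (\<integral>s. indicat_real S s *\<^sub>R indicat_real (S' \<inter> {..s}) r *\<^sub>R k s r \<partial>N) \<partial>N)"
    by (rule NN.Fubini_integral[OF integrable_triangle_pair, symmetric])
  also have "\<dots> = (LINT r:S'|N. LINT s:S\<inter>{r..}|N. k s r)"
    by (simp only: triangle_swap_eq) (simp add: set_lebesgue_integral_def)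
  finally show ?thesis .
qed

end

text \<open>Symmetry exchanges the triangles below and above the diagonal, and the diagonal is a null set. Both
  forms are needed: on $[0,t]$ the lower triangle has the sections $[0,s]$ of a forward equation, on
  $[t,T]$ the upper one has the sections $[s,T]$ of a backward equation.\<close>

lemma square_integral_symmetric:
  fixes k :: "real \<Rightarrow> real \<Rightarrow> real"
  assumes k: "integrable (N \<Otimes>\<^sub>M N) (case_prod k)" and S [measurable]: "S \<in> sets borel"
    and sym: "\<And>s r. k s r = k r s"
  shows "(LINT s:S|N. LINT r:S|N. k s r) = 2 * (LINT s:S|N. LINT r:S\<inter>{..s}|N. k s r)"
    and "(LINT s:S|N. LINT r:S|N. k s r) = 2 * (LINT s:S|N. LINT r:S\<inter>{s..}|N. k s r)"
proof -
  note mS [measurable] = measurable_pred_time_interval[OF S, of 0 T]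
  have k': "integrable (N \<Otimes>\<^sub>M N) (case_prod (\<lambda>s r. k r s))"
    using k by (simp only: sym[symmetric])
  have eq: "(LINT s:S|N. LINT r:S\<inter>{s..}|N. k s r) = (LINT s:S|N. LINT r:S\<inter>{..s}|N. k s r)"
    using triangle_swap[OF k S S] by (simp only: sym)
  have "AE s in N. integrable N (\<lambda>r. k s r)"
    using NN.AE_integrable_fst[OF k] .
  then have AE: "AE s in N. indicat_real S s *\<^sub>R (LINT r:S|N. k s r)
      = indicat_real S s *\<^sub>R ((LINT r:S\<inter>{..s}|N. k s r) + (LINT r:S\<inter>{s..}|N. k s r))"
  proof eventually_elim
    fix s assume int: "integrable N (\<lambda>r. k s r)"
    note [measurable] = borel_measurable_integrable[OF int]
    have ints: "integrable N (\<lambda>r. indicat_real A r *\<^sub>R k s r)" if "A \<in> sets borel" for A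
    proof (rule Bochner_Integration.integrable_bound[OF int])
      note [measurable] = measurable_pred_time_interval[OF that, of 0 T]
      show "(\<lambda>r. indicat_real A r *\<^sub>R k s r) \<in> borel_measurable N" by measurable
    qed (auto simp: indicator_def)
    have "(LINT r:S|N. k s r)
        = (\<integral>r. indicat_real (S\<inter>{..s}) r *\<^sub>R k s r + indicat_real (S\<inter>{s..}) r *\<^sub>R k s r \<partial>N)"
      unfolding set_lebesgue_integral_def
    proof (rule integral_cong_AE)
      show "AE r in N. indicat_real S r *\<^sub>R k s r
          = indicat_real (S\<inter>{..s}) r *\<^sub>R k s r + indicat_real (S\<inter>{s..}) r *\<^sub>R k s r"
        using AE_time_interval_neq[of s 0 T]
        by eventually_elim (auto simp: indicator_def)
      show "(\<lambda>r. indicat_real S r *\<^sub>R k s r) \<in> borel_measurable N"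
        by (rule borel_measurable_integrable[OF ints[OF S]])
      show "(\<lambda>r. indicat_real (S\<inter>{..s}) r *\<^sub>R k s r + indicat_real (S\<inter>{s..}) r *\<^sub>R k s r)
          \<in> borel_measurable N"
        by (intro borel_measurable_add borel_measurable_integrable ints) (use S in auto)
    qed
    also have "\<dots> = (LINT r:S\<inter>{..s}|N. k s r) + (LINT r:S\<inter>{s..}|N. k s r)"
      by (simp add: ints set_lebesgue_integral_def del: real_scaleR_def)
    finally show "indicat_real S s *\<^sub>R (LINT r:S|N. k s r)
      = indicat_real S s *\<^sub>R ((LINT r:S\<inter>{..s}|N. k s r) + (LINT r:S\<inter>{s..}|N. k s r))"
      by simp
  qed
  have cong: "(LINT s:S|N. P s) = (LINT s:S|N. Q s)"
    if "set_integrable N S P" "set_integrable N S Q"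
      "AE s in N. indicat_real S s *\<^sub>R P s = indicat_real S s *\<^sub>R Q s" for P Q :: "real \<Rightarrow> real"
    using that unfolding set_lebesgue_integral_def set_integrable_def
    by (intro integral_cong_AE borel_measurable_integrable) auto
  have le: "set_integrable N S (\<lambda>s. LINT r:S\<inter>{..s}|N. k s r)"
    by (rule set_integrable_triangle_le[OF k S S])
  have ge: "set_integrable N S (\<lambda>s. LINT r:S\<inter>{s..}|N. k s r)"
    using set_integrable_triangle_ge[OF k' S S] .
  have "integrable (N \<Otimes>\<^sub>M N) (\<lambda>(s, r). indicat_real S s *\<^sub>R indicat_real S r *\<^sub>R k s r)"
    by (rule Bochner_Integration.integrable_bound[OF k])
       (use borel_measurable_integrable[OF k] in \<open>measurable, auto simp: indicator_def\<close>)
  from NN.integrable_fst[OF this]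
  have "set_integrable N S (\<lambda>s. LINT r:S|N. k s r)"
    by (simp add: set_integrable_def set_lebesgue_integral_def)
  then have "(LINT s:S|N. LINT r:S|N. k s r)
      = (LINT s:S|N. (LINT r:S\<inter>{..s}|N. k s r) + (LINT r:S\<inter>{s..}|N. k s r))"
    by (rule cong) (use set_integral_add(1)[OF le ge] AE in auto)
  also have "\<dots> = (LINT s:S|N. LINT r:S\<inter>{..s}|N. k s r) + (LINT s:S|N. LINT r:S\<inter>{s..}|N. k s r)"
    by (rule set_integral_add(2)[OF le ge])
  finally show "(LINT s:S|N. LINT r:S|N. k s r) = 2 * (LINT s:S|N. LINT r:S\<inter>{..s}|N. k s r)"
    "(LINT s:S|N. LINT r:S|N. k s r) = 2 * (LINT s:S|N. LINT r:S\<inter>{s..}|N. k s r)"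
    using eq by simp_all
qed

end

section \<open>Energy identities\<close>

text \<open>What remains of two solutions after taking differences: $x$ and $V$ solve a forward and a backward
  equation with drifts $f$ and $g$. The stochastic integral $I_t$ over $[t,T]$ enters only through
  its orthogonality to what is known at time $t$.\<close>

locale coupled_differences = random_evolution T M for T :: real and M :: "'a measure" +
  fixes f g x V I :: "real \<Rightarrow> 'a \<Rightarrow> 'b::euclidean_space" and h x0 :: "'a \<Rightarrow> 'b"
  assumes T_nonneg: "0 \<le> T"
    and f: "L2_process N M f" and g: "L2_process N M g"
    and h: "h \<in> L2_rv M" and x0: "x0 \<in> L2_rv M"
    and x: "\<And>t. t \<in> {0..T} \<Longrightarrow> x t \<in> L2_rv M"
    and V: "\<And>t. t \<in> {0..T} \<Longrightarrow> V t \<in> L2_rv M"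
    and I: "\<And>t. t \<in> {0..T} \<Longrightarrow> I t \<in> L2_rv M"
    and x_eq: "\<And>t. t \<in> {0..T} \<Longrightarrow> AE \<omega> in M. x t \<omega> = x0 \<omega> - (LINT s:{0..t}|N. f s \<omega>)"
    and V_eq: "\<And>t. t \<in> {0..T} \<Longrightarrow>
      AE \<omega> in M. V t \<omega> = h \<omega> + (LINT s:{t..T}|N. g s \<omega>) - I t \<omega>"
    and orth_V: "\<And>t. t \<in> {0..T} \<Longrightarrow> L2_inner M (V t) (I t) = 0"
    and orth_f: "\<And>t. t \<in> {0..T} \<Longrightarrow> L2_inner M (f t) (I t) = 0"
    and orth_g: "\<And>t. t \<in> {0..T} \<Longrightarrow> L2_inner M (g t) (I t) = 0"
    and orth_x0: "L2_inner M x0 (I 0) = 0"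
begin

lemma f_L2: "t \<in> {0..T} \<Longrightarrow> f t \<in> L2_rv M" and g_L2: "t \<in> {0..T} \<Longrightarrow> g t \<in> L2_rv M"
  using L2_processD(2)[OF f] L2_processD(2)[OF g] by auto

lemma integral_f_L2: "(\<lambda>\<omega>. LINT s:{a..b}|N. f s \<omega>) \<in> L2_rv M"
  and integral_g_L2: "(\<lambda>\<omega>. LINT s:{a..b}|N. g s \<omega>) \<in> L2_rv M"
  by (intro L2_process_integral f g measurable_pred_time_interval, simp)+

lemma inner_x:
  assumes t: "t \<in> {0..T}" and c: "c \<in> L2_rv M"
  shows "L2_inner M c (x t) = L2_inner M c x0 - (LINT s:{0..t}|N. L2_inner M c (f s))"
proof -
  have "L2_inner M c (x t) = L2_inner M c (\<lambda>\<omega>. x0 \<omega> - (LINT s:{0..t}|N. f s \<omega>))"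
    using t by (intro L2_inner_cong_AE c x x_eq L2_rv_diff x0 integral_f_L2) auto
  also have "\<dots> = L2_inner M c x0 - (LINT s:{0..t}|N. L2_inner M c (f s))"
    by (simp add: L2_inner_diff_right x0 c integral_f_L2
        inner_integral_process[OF f measurable_pred_time_interval])
  finally show ?thesis .
qed

text \<open>The term with $I_t$ stays on the left, since this identity is also applied to test variables that
  are not known at time $t$.\<close>

lemma inner_V:
  assumes t: "t \<in> {0..T}" and c: "c \<in> L2_rv M"
  shows "L2_inner M c (V t) + L2_inner M c (I t)
    = L2_inner M c h + (LINT s:{t..T}|N. L2_inner M c (g s))"
proof -
  have "L2_inner M c (V t) = L2_inner M c (\<lambda>\<omega>. h \<omega> + (LINT s:{t..T}|N. g s \<omega>) - I t \<omega>)"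
    using t by (intro L2_inner_cong_AE c V V_eq I L2_rv_diff L2_rv_add h integral_g_L2) auto
  also have "\<dots> = L2_inner M c h + (LINT s:{t..T}|N. L2_inner M c (g s)) - L2_inner M c (I t)"
    by (simp add: L2_inner_diff_right L2_inner_add_right L2_rv_add h c I[OF t] integral_g_L2
        inner_integral_process[OF g measurable_pred_time_interval])
  finally show ?thesis by simp
qed

lemma inner_process_set_integrable:
  "L2_process N M e \<Longrightarrow> c \<in> L2_rv M \<Longrightarrow> set_integrable N {a..b} (\<lambda>s. L2_inner M (e s) c)"
  using inner_process_integrable[OF _ measurable_pred_time_interval, of e "{a..b}" c]
  by (simp add: L2_inner_commute)

lemma
  assumes e: "L2_process N M e" and ab: "0 \<le> a" "b \<le> T"
  shows integrable_triangle_f: "set_integrable N {a..b} (\<lambda>s. LINT r:{0..s}|N. L2_inner M (e s) (f r))"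
    and integrable_triangle_g: "set_integrable N {a..b} (\<lambda>s. LINT r:{s..T}|N. L2_inner M (e s) (g r))"
proof -
  have sets: "{0..T} \<inter> {..s} = {0..s}" "{0..T} \<inter> {s..} = {s..T}" if "s \<in> {a..b}" for s
    using that ab by auto
  have "set_integrable N {a..b} (\<lambda>s. LINT r:{0..T}\<inter>{..s}|N. L2_inner M (e s) (f r))"
    by (rule set_integrable_triangle_le[OF inner_kernel_integrable[OF e f]]) auto
  then show "set_integrable N {a..b} (\<lambda>s. LINT r:{0..s}|N. L2_inner M (e s) (f r))"
    by (rule set_integrable_eq) (simp only: sets)
  have "set_integrable N {a..b} (\<lambda>s. LINT r:{0..T}\<inter>{s..}|N. L2_inner M (g r) (e s))"
    by (rule set_integrable_triangle_ge[OF inner_kernel_integrable[OF g e]]) auto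
  then show "set_integrable N {a..b} (\<lambda>s. LINT r:{s..T}|N. L2_inner M (e s) (g r))"
    by (rule set_integrable_eq) (simp only: sets L2_inner_commute[of _ "e _" "g _"])
qed

lemma
  assumes e: "L2_process N M e" and ab: "0 \<le> a" "b \<le> T"
  shows integrable_inner_x: "set_integrable N {a..b} (\<lambda>s. L2_inner M (e s) (x s))"
    and integral_inner_x: "(LINT s:{a..b}|N. L2_inner M (e s) (x s))
      = (LINT s:{a..b}|N. L2_inner M (e s) x0)
        - (LINT s:{a..b}|N. LINT r:{0..s}|N. L2_inner M (e s) (f r))"
proof -
  have eq: "L2_inner M (e s) (x s) = L2_inner M (e s) x0 - (LINT r:{0..s}|N. L2_inner M (e s) (f r))"
    if "s \<in> {a..b}" for s
    using that ab L2_processD(2)[OF e] by (intro inner_x) auto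
  note * = set_integral_diff[OF inner_process_set_integrable[OF e x0] integrable_triangle_f[OF e ab]]
  show "set_integrable N {a..b} (\<lambda>s. L2_inner M (e s) (x s))"
    using *(1) by (rule set_integrable_eq) (simp add: eq)
  show "(LINT s:{a..b}|N. L2_inner M (e s) (x s))
      = (LINT s:{a..b}|N. L2_inner M (e s) x0)
        - (LINT s:{a..b}|N. LINT r:{0..s}|N. L2_inner M (e s) (f r))"
    unfolding *(2)[symmetric] by (rule set_integral_eq) (rule eq)
qed

lemma
  assumes e: "L2_process N M e" and ab: "0 \<le> a" "b \<le> T"
    and orth: "\<And>t. t \<in> {0..T} \<Longrightarrow> L2_inner M (e t) (I t) = 0"
  shows integrable_inner_V: "set_integrable N {a..b} (\<lambda>s. L2_inner M (e s) (V s))"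
    and integral_inner_V: "(LINT s:{a..b}|N. L2_inner M (e s) (V s))
      = (LINT s:{a..b}|N. L2_inner M (e s) h)
        + (LINT s:{a..b}|N. LINT r:{s..T}|N. L2_inner M (e s) (g r))"
proof -
  have eq: "L2_inner M (e s) (V s) = L2_inner M (e s) h + (LINT r:{s..T}|N. L2_inner M (e s) (g r))"
    if "s \<in> {a..b}" for s
    using that ab L2_processD(2)[OF e] orth[of s] inner_V[of s "e s"] by auto
  note * = set_integral_add[OF inner_process_set_integrable[OF e h] integrable_triangle_g[OF e ab]]
  show "set_integrable N {a..b} (\<lambda>s. L2_inner M (e s) (V s))"
    using *(1) by (rule set_integrable_eq) (simp add: eq)
  show "(LINT s:{a..b}|N. L2_inner M (e s) (V s))
      = (LINT s:{a..b}|N. L2_inner M (e s) h)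
        + (LINT s:{a..b}|N. LINT r:{s..T}|N. L2_inner M (e s) (g r))"
    unfolding *(2)[symmetric] by (rule set_integral_eq) (rule eq)
qed

text \<open>Expanding $\|x_0 - \int_0^t f\|^2$ produces an integral of $\langle f_s, f_r\rangle$ over the square
  $[0,t]^2$. It is twice the integral over the triangle $r \le s$, and this is exactly the correction
  that turns $x_0$ into $x_s$ in the linear term $-2\int_0^t \langle f_s, x_0\rangle\,ds$.\<close>

lemma forward_energy:
  assumes t: "t \<in> {0..T}"
  shows "(L2_nrm M (x t))\<^sup>2 = (L2_nrm M x0)\<^sup>2 - 2 * (LINT s:{0..t}|N. L2_inner M (f s) (x s))"
proof -
  let ?A = "LINT s:{0..t}|N. L2_inner M (f s) x0"
  let ?D = "\<lambda>s. LINT r:{0..t}|N. L2_inner M (f s) (f r)"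
  have D: "?D s = L2_inner M (f s) x0 - L2_inner M (f s) (x t)" if "s \<in> {0..t}" for s
    using inner_x[OF t, of "f s"] f_L2[of s] that t by auto
  have "L2_inner M (x t) (x t) = L2_inner M x0 (x t) - (LINT s:{0..t}|N. L2_inner M (f s) (x t))"
    using inner_x[OF t x[OF t]] by (simp add: L2_inner_commute[of M "x t" "f _"]
        L2_inner_commute[of M "x t" x0])
  also have "L2_inner M x0 (x t) = L2_inner M x0 x0 - ?A"
    using inner_x[OF t x0] by (simp add: L2_inner_commute[of M x0 "f _"])
  also have "(LINT s:{0..t}|N. L2_inner M (f s) (x t)) = ?A - (LINT s:{0..t}|N. ?D s)"
  proof -
    have "(LINT s:{0..t}|N. ?D s)
        = (LINT s:{0..t}|N. L2_inner M (f s) x0 - L2_inner M (f s) (x t))"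
      by (rule set_integral_eq) (rule D)
    then show ?thesis
      using set_integral_diff(2)[OF inner_process_set_integrable[OF f x0]
          inner_process_set_integrable[OF f x[OF t]], of 0 t] by simp
  qed
  also have "(LINT s:{0..t}|N. ?D s)
      = 2 * (LINT s:{0..t}|N. LINT r:{0..t}\<inter>{..s}|N. L2_inner M (f s) (f r))"
    by (rule square_integral_symmetric(1)[OF inner_kernel_integrable[OF f f]])
       (auto intro: L2_inner_commute)
  also have "(LINT s:{0..t}|N. LINT r:{0..t}\<inter>{..s}|N. L2_inner M (f s) (f r))
      = (LINT s:{0..t}|N. LINT r:{0..s}|N. L2_inner M (f s) (f r))"
  proof (rule set_integral_eq)
    fix s assume "s \<in> {0..t}"
    then have "{0..t} \<inter> {..s} = {0..s}" by auto
    then show "(LINT r:{0..t}\<inter>{..s}|N. L2_inner M (f s) (f r)) = (LINT r:{0..s}|N. L2_inner M (f s) (f r))"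
      by (simp only:)
  qed
  finally show ?thesis
    using integral_inner_x[OF f, of 0 t] t by (simp add: L2_nrm_squared)
qed

text \<open>The same computation for $V_t + I_t = h + \int_t^T g$, with triangles $r \ge s$. It is an inequality
  because $\|I_t\|^2$ is dropped; inside the time integral $I_s$ disappears altogether, being
  orthogonal to $g_s$.\<close>

lemma backward_energy:
  assumes t: "t \<in> {0..T}"
  shows "(L2_nrm M (V t))\<^sup>2 \<le> (L2_nrm M h)\<^sup>2 + 2 * (LINT s:{t..T}|N. L2_inner M (g s) (V s))"
proof -
  define Q where "Q \<omega> = V t \<omega> + I t \<omega>" for \<omega>
  have Q: "Q \<in> L2_rv M" unfolding Q_def using V[OF t] I[OF t] by auto
  have inner_Q: "L2_inner M c Q = L2_inner M c h + (LINT s:{t..T}|N. L2_inner M c (g s))"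
    if "c \<in> L2_rv M" for c
    using inner_V[OF t that] that V[OF t] I[OF t] by (simp add: Q_def[abs_def] L2_inner_add_right)
  let ?A = "LINT s:{t..T}|N. L2_inner M (g s) h"
  let ?D = "\<lambda>s. LINT r:{t..T}|N. L2_inner M (g s) (g r)"
  have D: "?D s = L2_inner M (g s) Q - L2_inner M (g s) h" if "s \<in> {t..T}" for s
    using inner_Q[of "g s"] g_L2[of s] that t by auto
  \<comment> \<open>Orthogonality of the stochastic integral and the current value turns the square of the
    sum into the sum of the squares.\<close>
  have "L2_inner M Q Q = L2_inner M (V t) (V t) + L2_inner M (I t) (I t)"
    unfolding Q_def[abs_def] using V[OF t] I[OF t] orth_V[OF t]
    by (simp add: L2_inner_add_right L2_inner_add_left L2_rv_add L2_inner_commute[of M "I t" "V t"])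
  then have "L2_inner M (V t) (V t) \<le> L2_inner M Q Q" by simp
  also have "L2_inner M Q Q = L2_inner M h Q + (LINT s:{t..T}|N. L2_inner M (g s) Q)"
    using inner_Q[OF Q] by (simp add: L2_inner_commute[of M Q "g _"] L2_inner_commute[of M Q h])
  also have "L2_inner M h Q = L2_inner M h h + ?A"
    using inner_Q[OF h] by (simp add: L2_inner_commute[of M h "g _"])
  also have "(LINT s:{t..T}|N. L2_inner M (g s) Q) = ?A + (LINT s:{t..T}|N. ?D s)"
  proof -
    have "(LINT s:{t..T}|N. ?D s) = (LINT s:{t..T}|N. L2_inner M (g s) Q - L2_inner M (g s) h)"
      by (rule set_integral_eq) (rule D)
    then show ?thesis
      using set_integral_diff(2)[OF inner_process_set_integrable[OF g Q]
          inner_process_set_integrable[OF g h], of t T] by simp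
  qed
  also have "(LINT s:{t..T}|N. ?D s)
      = 2 * (LINT s:{t..T}|N. LINT r:{t..T}\<inter>{s..}|N. L2_inner M (g s) (g r))"
    by (rule square_integral_symmetric(2)[OF inner_kernel_integrable[OF g g]])
       (auto intro: L2_inner_commute)
  also have "(LINT s:{t..T}|N. LINT r:{t..T}\<inter>{s..}|N. L2_inner M (g s) (g r))
      = (LINT s:{t..T}|N. LINT r:{s..T}|N. L2_inner M (g s) (g r))"
  proof (rule set_integral_eq)
    fix s assume "s \<in> {t..T}"
    then have "{t..T} \<inter> {s..} = {s..T}" by auto
    then show "(LINT r:{t..T}\<inter>{s..}|N. L2_inner M (g s) (g r)) = (LINT r:{s..T}|N. L2_inner M (g s) (g r))"
      by (simp only:)
  qed
  finally show ?thesis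
    using integral_inner_V[OF g _ _ orth_g, of t T] t by (simp add: L2_nrm_squared)
qed

text \<open>Integration by parts between the two equations. Replacing $x_0$ by $x_s$ against $g_s$ and $h$ by
  $V_s$ against $f_s$ costs an integral of $\langle g_s, f_r\rangle$ over $r \le s$ each, and with their
  opposite signs these cancel.\<close>

lemma duality:
  "L2_inner M (V 0) x0 = L2_inner M h (x T)
    + (LINT s:{0..T}|N. L2_inner M (g s) (x s) + L2_inner M (f s) (V s))"
proof -
  have sets: "{0..T} \<inter> {..s} = {0..s}" "{0..T} \<inter> {s..} = {s..T}" if "s \<in> {0..T}" for s
    using that by auto
  have "(LINT s:{0..T}|N. LINT r:{0..T}\<inter>{..s}|N. L2_inner M (g s) (f r))
      = (LINT r:{0..T}|N. LINT s:{0..T}\<inter>{r..}|N. L2_inner M (g s) (f r))"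
    by (rule triangle_swap[OF inner_kernel_integrable[OF g f]]) auto
  moreover have "(LINT s:{0..T}|N. LINT r:{0..T}\<inter>{..s}|N. L2_inner M (g s) (f r))
      = (LINT s:{0..T}|N. LINT r:{0..s}|N. L2_inner M (g s) (f r))"
    by (rule set_integral_eq) (simp only: sets)
  moreover have "(LINT s:{0..T}|N. LINT r:{0..T}\<inter>{s..}|N. L2_inner M (g r) (f s))
      = (LINT s:{0..T}|N. LINT r:{s..T}|N. L2_inner M (f s) (g r))"
    by (rule set_integral_eq) (simp only: sets L2_inner_commute[of M "f _" "g _"])
  ultimately have swap: "(LINT s:{0..T}|N. LINT r:{0..s}|N. L2_inner M (g s) (f r))
      = (LINT s:{0..T}|N. LINT r:{s..T}|N. L2_inner M (f s) (g r))" by simp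
  have "L2_inner M x0 (V 0) = L2_inner M x0 h + (LINT s:{0..T}|N. L2_inner M (g s) x0)"
    using inner_V[of 0 x0] x0 T_nonneg orth_x0 by (simp add: L2_inner_commute[of M x0 "g _"])
  moreover have "L2_inner M h (x T) = L2_inner M x0 h - (LINT s:{0..T}|N. L2_inner M (f s) h)"
    using inner_x[of T h] h T_nonneg by (simp add: L2_inner_commute[of M h "f _"] L2_inner_commute[of M h x0])
  moreover have "(LINT s:{0..T}|N. L2_inner M (g s) (x s) + L2_inner M (f s) (V s))
      = (LINT s:{0..T}|N. L2_inner M (g s) (x s)) + (LINT s:{0..T}|N. L2_inner M (f s) (V s))"
    by (rule set_integral_add(2)[OF integrable_inner_x[OF g] integrable_inner_V[OF f _ _ orth_f]]) auto
  ultimately show ?thesis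
    using integral_inner_x[OF g, of 0 T] integral_inner_V[OF f _ _ orth_f, of 0 T] swap
    by (simp add: L2_inner_commute[of M "V 0" x0])
qed

end

section \<open>A Gronwall inequality\<close>

text \<open>Let $m$ be the supremum of $u(t) e^{-2Kt}$, which is finite because the hypothesis bounds $u$. The
  weight is chosen so that $K\int_0^t m e^{2Ks}\,ds \le \frac m2 e^{2Kt}$; hence
  $m \le c + \frac m2$, that is $m \le 2c$.\<close>

lemma Gronwall_integrable:
  fixes u :: "real \<Rightarrow> real"
  assumes u: "set_integrable lborel {0..T} u"
    and nonneg: "\<And>t. t \<in> {0..T} \<Longrightarrow> 0 \<le> u t"
    and K: "0 < K" and c: "0 \<le> c"
    and le: "\<And>t. t \<in> {0..T} \<Longrightarrow> u t \<le> c + K * (LINT s:{0..t}|lborel. u s)"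
    and t: "t \<in> {0..T}"
  shows "u t \<le> 2 * c * exp (2 * K * T)"
proof -
  define J where "J = (LINT s:{0..T}|lborel. u s)"
  have sub: "set_integrable lborel {0..r} u" if "r \<in> {0..T}" for r
    using u by (rule set_integrable_subset) (use that in auto)
  have u_le: "u r \<le> c + K * J" if "r \<in> {0..T}" for r
  proof -
    have "(LINT s:{0..r}|lborel. u s) \<le> J"
      using sub[OF that] u nonneg that
      unfolding J_def set_integrable_def set_lebesgue_integral_def
      by (intro integral_mono) (auto simp: indicator_def)
    with le[OF that] K show ?thesis
      by (meson add_left_mono mult_left_mono less_imp_le order_trans)
  qed
  have bdd: "bdd_above ((\<lambda>r. u r * exp (- (2 * K * r))) ` {0..T})"
  proof (rule bdd_aboveI2)
    fix r assume r: "r \<in> {0..T}"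
    have "u r * exp (- (2 * K * r)) \<le> (c + K * J) * 1"
      by (rule mult_mono[OF u_le[OF r]]) (use r K nonneg[OF r] u_le[OF r] in auto)
    then show "u r * exp (- (2 * K * r)) \<le> c + K * J" by simp
  qed
  define m where "m = (SUP r\<in>{0..T}. u r * exp (- (2 * K * r)))"
  have m_ge: "u r \<le> m * exp (2 * K * r)" if "r \<in> {0..T}" for r
  proof -
    have "u r * exp (- (2 * K * r)) \<le> m"
      unfolding m_def by (rule cSUP_upper[OF that bdd])
    then show ?thesis by (simp add: exp_minus field_simps)
  qed
  have m0: "0 \<le> m"
    using m_ge[OF t] nonneg[OF t] by (meson exp_gt_zero order_trans zero_le_mult_iff not_less)
  have "u r * exp (- (2 * K * r)) \<le> c + m / 2" if r: "r \<in> {0..T}" for r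
  proof -
    have FTC: "has_bochner_integral lborel (\<lambda>s. indicator {0..r} s *\<^sub>R (m * exp (2 * K * s)))
        (m / (2 * K) * exp (2 * K * r) - m / (2 * K) * exp (2 * K * 0))"
      by (rule has_bochner_integral_FTC_Icc)
         (use r K in \<open>auto intro!: derivative_eq_intros continuous_intros
            simp flip: has_real_derivative_iff_has_vector_derivative\<close>)
    have "(LINT s:{0..r}|lborel. u s) \<le> (LINT s:{0..r}|lborel. m * exp (2 * K * s))"
      by (rule set_integral_mono[OF sub[OF r]])
         (use r m_ge FTC in \<open>auto simp: set_integrable_def dest: has_bochner_integral_integrable
             intro: integrable.intros\<close>)
    also have "\<dots> = m / (2 * K) * exp (2 * K * r) - m / (2 * K) * exp (2 * K * 0)"
      unfolding set_lebesgue_integral_def by (rule has_bochner_integral_integral_eq[OF FTC])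
    also have "\<dots> \<le> m / (2 * K) * exp (2 * K * r)" using m0 K by simp
    finally have "K * (LINT s:{0..r}|lborel. u s) \<le> m / 2 * exp (2 * K * r)"
      using K by (simp add: field_simps)
    then have "u r \<le> c * 1 + m / 2 * exp (2 * K * r)" using le[OF r] by simp
    also have "\<dots> \<le> c * exp (2 * K * r) + m / 2 * exp (2 * K * r)"
      using c K r by (intro add_right_mono mult_left_mono) auto
    finally show ?thesis by (simp add: exp_minus field_simps)
  qed
  then have "m \<le> c + m / 2"
    unfolding m_def using t by (intro cSUP_least) auto
  then have "m \<le> 2 * c" by simp
  have "u t \<le> m * exp (2 * K * t)" by (rule m_ge[OF t])
  also have "\<dots> \<le> 2 * c * exp (2 * K * T)"
    using \<open>m \<le> 2 * c\<close> m0 c K t by (intro mult_mono) auto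
  finally show ?thesis .
qed

section \<open>Closing the estimate with Hoelder exponents\<close>

lemma max_powr_scale_le:
  fixes c S \<gamma> :: real
  assumes "1 \<le> c" "0 \<le> S" "0 < \<gamma>" "\<gamma> \<le> 1"
  shows "max (c * S) ((c * S) powr \<gamma>) \<le> c * max S (S powr \<gamma>)"
proof -
  have "c powr \<gamma> \<le> c powr 1" using assms by (intro powr_mono) auto
  then have "(c * S) powr \<gamma> \<le> c * S powr \<gamma>"
    using assms by (simp add: powr_mult mult_right_mono)
  also have "\<dots> \<le> c * max S (S powr \<gamma>)" using assms by (intro mult_left_mono) auto
  finally show ?thesis using assms by (auto intro: mult_left_mono)
qed

lemma max_powr_squared:
  fixes a \<gamma> :: real
  assumes "0 \<le> a"
  shows "(max a (a powr \<gamma>))\<^sup>2 = max (a\<^sup>2) (a\<^sup>2 powr \<gamma>)"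
proof -
  have "a\<^sup>2 powr \<gamma> = (a powr \<gamma>)\<^sup>2"
    using assms by (simp add: powr_mult power2_eq_square)
  moreover have "(max p q)\<^sup>2 = max (p\<^sup>2) (q\<^sup>2)" if "0 \<le> p" "0 \<le> q" for p q :: real
    using that by (auto simp: max_def power2_le_iff_abs_le power_mono)
  ultimately show ?thesis using assms by simp
qed

lemma max_powr_mono:
  fixes a b \<gamma> :: real
  assumes "0 \<le> a" "a \<le> b" "0 < \<gamma>"
  shows "max a (a powr \<gamma>) \<le> max b (b powr \<gamma>)"
  using assms powr_mono2[of \<gamma> a b] by (auto simp: max_def)

text \<open>Here $e = \|x_0\|$ is given, $a = \|V_0\|$ is to be bounded, and $S$ controls all other norms. If
  $a > e$, then $S \le 2ae$ and the hypothesis says that $a^2$ is at most a constant times $ae$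
  or $(ae)^\gamma$. In the second case $a^{2-\gamma}$ is of order $e^\gamma$, which is the origin of the
  exponent $\gamma/(2-\gamma)$. Consequently $S$ is of order $e^{1+\gamma/(2-\gamma)} = e^{2/(2-\gamma)}$, the
  square of $e^{1/(2-\gamma)}$. The maxima with $e$ take care of large distances.\<close>

lemma hoelder_closure:
  fixes a e \<gamma> K :: real
  defines "S \<equiv> a * e + e\<^sup>2"
    and "n1 \<equiv> max e (e powr (\<gamma> / (2 - \<gamma>)))" and "n2 \<equiv> max e (e powr (1 / (2 - \<gamma>)))"
  assumes \<gamma>: "0 < \<gamma>" "\<gamma> \<le> 1" and K: "1 \<le> K" and a: "0 \<le> a" and e: "0 \<le> e"
    and le: "a\<^sup>2 \<le> K * max S (S powr \<gamma>)"
  shows "S \<le> (2 * K + 1) * n2\<^sup>2" and "max S (S powr \<gamma>) \<le> (2 * K + 1) * n1\<^sup>2"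
proof -
  have S: "0 \<le> S" using a e by (simp add: S_def)
  have g2: "0 < 2 - \<gamma>" "1 \<le> 2 - \<gamma>" using \<gamma> by auto
  have n1: "e \<le> n1" "e powr (\<gamma> / (2 - \<gamma>)) \<le> n1" "0 \<le> n1" using e by (auto simp: n1_def)
  have n2: "e \<le> n2" "e powr (1 / (2 - \<gamma>)) \<le> n2" "0 \<le> n2" using e by (auto simp: n2_def)
  have a_le: "a \<le> 2 * K * n1"
  proof (cases "a \<le> e")
    case True
    also have "e \<le> 1 * n1" using n1 by simp
    also have "\<dots> \<le> 2 * K * n1" using K n1 by (intro mult_right_mono) auto
    finally show ?thesis .
  next
    case False
    then have a0: "0 < a" and "e * e \<le> a * e" using e by (auto intro: mult_right_mono)
    then have "S \<le> 2 * (a * e)" by (simp add: S_def power2_eq_square)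
    then have "max S (S powr \<gamma>) \<le> max (2 * (a * e)) ((2 * (a * e)) powr \<gamma>)"
      using S \<gamma> by (intro max_powr_mono)
    also have "\<dots> \<le> 2 * max (a * e) ((a * e) powr \<gamma>)"
      using a e \<gamma> by (intro max_powr_scale_le) auto
    finally have "K * max S (S powr \<gamma>) \<le> K * (2 * max (a * e) ((a * e) powr \<gamma>))"
      using K by (intro mult_left_mono) auto
    with le have "a\<^sup>2 \<le> 2 * K * max (a * e) ((a * e) powr \<gamma>)"
      by (simp only: mult.left_commute[of 2 K] mult.assoc)
    then consider "a\<^sup>2 \<le> 2 * K * (a * e)" | "a\<^sup>2 \<le> 2 * K * (a * e) powr \<gamma>"
      by (auto simp: max_def split: if_splits)
    then show ?thesis
    proof cases
      case 1
      then have "a * a \<le> a * (2 * K * e)" by (simp add: power2_eq_square algebra_simps)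
      then have "a \<le> 2 * K * e" using a0 by simp
      also have "\<dots> \<le> 2 * K * n1" using K n1 by (intro mult_left_mono) auto
      finally show ?thesis .
    next
      case 2
      have "a powr (2 - \<gamma>) = a\<^sup>2 / a powr \<gamma>"
        using a0 by (simp add: powr_diff)
      also have "\<dots> \<le> 2 * K * e powr \<gamma>"
        using 2 a0 e by (simp add: powr_mult field_simps)
      finally have "(a powr (2 - \<gamma>)) powr (1 / (2 - \<gamma>)) \<le> (2 * K * e powr \<gamma>) powr (1 / (2 - \<gamma>))"
        using g2 by (intro powr_mono2) auto
      then have "a \<le> (2 * K) powr (1 / (2 - \<gamma>)) * e powr (\<gamma> / (2 - \<gamma>))"
        using a0 g2 K e by (simp add: powr_powr powr_mult)
      also have "\<dots> \<le> (2 * K) powr 1 * n1"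
        using K g2 n1 by (intro mult_mono powr_mono) (auto simp: divide_le_eq)
      finally show ?thesis using K by simp
    qed
  qed
  have e2: "e\<^sup>2 \<le> n2\<^sup>2" using n2 e by (intro power_mono)
  have "e * e powr (\<gamma> / (2 - \<gamma>)) = (e powr (1 / (2 - \<gamma>)))\<^sup>2"
  proof (cases "e = 0")
    case False
    have "e * e powr (\<gamma> / (2 - \<gamma>)) = e powr (1 + \<gamma> / (2 - \<gamma>))"
      using e False by (simp add: powr_add)
    also have "1 + \<gamma> / (2 - \<gamma>) = 1 / (2 - \<gamma>) + 1 / (2 - \<gamma>)"
      using g2 by (simp add: field_simps)
    finally show ?thesis by (simp only: powr_add power2_eq_square)
  qed simp
  also have "\<dots> \<le> n2\<^sup>2" using n2 by (intro power_mono) auto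
  finally have en1: "e * n1 \<le> n2\<^sup>2"
    using e2 by (auto simp: n1_def max_def power2_eq_square)
  have "a * e \<le> 2 * K * n1 * e" using a_le e by (rule mult_right_mono)
  also have "\<dots> \<le> 2 * K * n2\<^sup>2"
    using en1 K by (simp add: mult.assoc mult.commute[of n1])
  finally show S_le: "S \<le> (2 * K + 1) * n2\<^sup>2"
    using e2 by (simp add: S_def algebra_simps)
  \<comment> \<open>For $e \le 1$ the smallest exponent dominates, for $e \ge 1$ the largest; $n_1$ contains both
    extremes.\<close>
  have pw: "e powr p \<le> n1" if "\<gamma> / (2 - \<gamma>) \<le> p" "p \<le> 1" for p
  proof (cases "e \<le> 1")
    case True
    then have "e powr p \<le> e powr (\<gamma> / (2 - \<gamma>))"
      using that e by (cases "e = 0") (auto intro: powr_mono')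
    with n1 show ?thesis by simp
  next
    case False
    then have "e powr p \<le> e powr 1" using that by (intro powr_mono) auto
    with n1 False show ?thesis by simp
  qed
  have "\<gamma> / (2 - \<gamma>) \<le> 1 / (2 - \<gamma>)" "1 / (2 - \<gamma>) \<le> 1" "\<gamma> / (2 - \<gamma>) \<le> \<gamma>"
    using \<gamma> g2 by (auto simp: divide_le_eq divide_right_mono)
  then have "n2 \<le> n1" and "n2 powr \<gamma> \<le> n1"
    using pw[of "1 / (2 - \<gamma>)"] pw[of \<gamma>] n1 \<gamma> by (auto simp: n2_def max_def powr_powr)
  then have "max n2 (n2 powr \<gamma>) \<le> n1" by simp
  then have "(max n2 (n2 powr \<gamma>))\<^sup>2 \<le> n1\<^sup>2" using n2 by (intro power_mono) auto
  then have *: "max (n2\<^sup>2) (n2\<^sup>2 powr \<gamma>) \<le> n1\<^sup>2" using n2 by (simp add: max_powr_squared)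
  have "max S (S powr \<gamma>) \<le> max ((2 * K + 1) * n2\<^sup>2) (((2 * K + 1) * n2\<^sup>2) powr \<gamma>)"
    using S S_le \<gamma> by (intro max_powr_mono)
  also have "\<dots> \<le> (2 * K + 1) * max (n2\<^sup>2) (n2\<^sup>2 powr \<gamma>)"
    using K \<gamma> by (intro max_powr_scale_le) auto
  also have "\<dots> \<le> (2 * K + 1) * n1\<^sup>2" using * K by (intro mult_left_mono) auto
  finally show "max S (S powr \<gamma>) \<le> (2 * K + 1) * n1\<^sup>2" .
qed

text \<open>The bound of the Gronwall lemma for the initial value $(1 + 2C/\alpha) S$ and the rate
  $2C(1 + L/\alpha)$, divided by $S$.\<close>

definition forward_const :: "real \<Rightarrow> real \<Rightarrow> real \<Rightarrow> real \<Rightarrow> real" where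
  "forward_const C \<alpha> L T = 2 * (1 + 2 * C / \<alpha>) * exp (2 * (2 * C * (1 + L / \<alpha>)) * T)"

text \<open>The three contributions to $\|V_t\|^2$ come from the terminal datum, from $\int \|x_s\|_\gamma^2\,ds$ and
  from $\int \|V_s\|^2\,ds$.\<close>

definition backward_const :: "real \<Rightarrow> real \<Rightarrow> real \<Rightarrow> real \<Rightarrow> real" where
  "backward_const C \<alpha> L T =
     (let K = forward_const C \<alpha> L T in C\<^sup>2 * K + 2 * C * (T * K + (1 + L * T * K) / \<alpha>))"

lemma backward_const_ge:
  assumes "1 \<le> C" "0 < \<alpha>" "0 \<le> L" "0 \<le> T"
  shows "1 \<le> forward_const C \<alpha> L T" and "forward_const C \<alpha> L T \<le> backward_const C \<alpha> L T"
proof -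
  define K where "K = forward_const C \<alpha> L T"
  have "1 * 1 \<le> 2 * (1 + 2 * C / \<alpha>) * exp (2 * (2 * C * (1 + L / \<alpha>)) * T)"
    using assms by (intro mult_mono) auto
  then have K: "1 \<le> K" by (simp add: K_def forward_const_def)
  then show "1 \<le> forward_const C \<alpha> L T" by (simp add: K_def)
  have "1 * K \<le> C\<^sup>2 * K"
    using K assms by (intro mult_right_mono) auto
  moreover have "0 \<le> 2 * C * (T * K + (1 + L * T * K) / \<alpha>)"
    using K assms by (intro mult_nonneg_nonneg add_nonneg_nonneg divide_nonneg_pos) auto
  ultimately have "K \<le> backward_const C \<alpha> L T"
    by (simp add: backward_const_def Let_def flip: K_def)
  then show "forward_const C \<alpha> L T \<le> backward_const C \<alpha> L T" by (simp add: K_def)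
qed

section \<open>Stability estimates\<close>

context coupled_differences
begin

lemma L2_process_nrm_set_integrable:
  assumes "L2_process N M e"
  shows "set_integrable N {a..b} (\<lambda>s. (L2_nrm M (e s))\<^sup>2)"
  unfolding set_integrable_def L2_nrm_squared
  using L2_process_norm_integrable[OF assms]
proof (rule Bochner_Integration.integrable_bound)
  have [measurable]: "(\<lambda>s. L2_inner M (e s) (e s)) \<in> borel_measurable N"
    by (rule borel_measurable_integrable[OF L2_process_norm_integrable[OF assms]])
  have [measurable]: "Measurable.pred N (\<lambda>s. s \<in> {a..b})"
    by (rule measurable_pred_time_interval) simp
  show "(\<lambda>s. indicat_real {a..b} s *\<^sub>R L2_inner M (e s) (e s)) \<in> borel_measurable N"
    by measurable
qed (auto simp: indicator_def)

lemma set_integral_mono_interval: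
  fixes u :: "real \<Rightarrow> real"
  assumes "set_integrable N {a..b} u" "set_integrable N {c..d} u"
    and "a \<le> c" "d \<le> b" "\<And>s. s \<in> {a..b} \<Longrightarrow> 0 \<le> u s"
  shows "(LINT s:{c..d}|N. u s) \<le> (LINT s:{a..b}|N. u s)"
  using assms unfolding set_lebesgue_integral_def set_integrable_def
  by (intro integral_mono) (auto simp: indicator_def)

lemma set_integrable_const: "a \<in> {0..T} \<Longrightarrow> b \<in> {a..T} \<Longrightarrow> set_integrable N {a..b} (\<lambda>_. c)" for c :: real
  by (subst set_integral_time_interval) (auto simp: set_integrable_def)

lemma set_integral_const: "a \<in> {0..T} \<Longrightarrow> b \<in> {a..T} \<Longrightarrow> (LINT s:{a..b}|N. c) = (b - a) * c" for c :: real
  by (subst set_integral_time_interval) (auto simp: set_lebesgue_integral_def)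

text \<open>Duality and monotonicity at the terminal time bound the integral of
  $\langle g, x\rangle + \langle f, V\rangle$ over $[0,T]$ by $\|V_0\| \|x_0\|$. The integrand is
  nonnegative, so the same bound holds over every $[0,t]$, where strong monotonicity then yields
  $\alpha \int_0^t \|V\|^2 \le S + L \int_0^t \|x\|^2$. Inserting this into the forward energy identity
  leaves a Gronwall inequality for $\|x_t\|^2$ alone, whatever the size of $L$. Once $x$ and $\int \|V\|^2$
  are controlled, the backward energy inequality bounds $V_t$.\<close>

lemma stability_estimates:
  fixes C \<alpha> L \<gamma> :: real
  defines "S \<equiv> L2_nrm M (V 0) * L2_nrm M x0 + (L2_nrm M x0)\<^sup>2"
  assumes C: "1 \<le> C" and \<alpha>: "0 < \<alpha>" and L: "0 \<le> L" and \<gamma>: "0 < \<gamma>" "\<gamma> \<le> 1"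
    and xp: "L2_process N M x" and Vp: "L2_process N M V"
    and terminal: "0 \<le> L2_inner M h (x T)"
    and mono: "\<And>t. t \<in> {0..T} \<Longrightarrow> 0 \<le> L2_inner M (g t) (x t) + L2_inner M (f t) (V t)"
    and strong: "\<And>t. t \<in> {0..T} \<Longrightarrow> \<alpha> * (L2_nrm M (V t))\<^sup>2 - L * (L2_nrm M (x t))\<^sup>2
      \<le> L2_inner M (g t) (x t) + L2_inner M (f t) (V t)"
    and f_lower: "\<And>t. t \<in> {0..T} \<Longrightarrow>
      - C * ((L2_nrm M (x t))\<^sup>2 + (L2_nrm M (V t))\<^sup>2) \<le> L2_inner M (f t) (x t)"
    and g_upper: "\<And>t. t \<in> {0..T} \<Longrightarrow>
      L2_inner M (g t) (V t) \<le> C * ((L2_nrm_exp M \<gamma> (x t))\<^sup>2 + (L2_nrm M (V t))\<^sup>2)"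
    and h_le: "L2_nrm M h \<le> C * L2_nrm_exp M \<gamma> (x T)"
    and t: "t \<in> {0..T}"
  shows "(L2_nrm M (x t))\<^sup>2 \<le> forward_const C \<alpha> L T * S"
    and "(L2_nrm M (V t))\<^sup>2 \<le> backward_const C \<alpha> L T * max S (S powr \<gamma>)"
proof -
  define K1 where "K1 = forward_const C \<alpha> L T"
  define D where "D s = L2_inner M (g s) (x s) + L2_inner M (f s) (V s)" for s
  let ?\<xi> = "\<lambda>s. (L2_nrm M (x s))\<^sup>2" and ?v = "\<lambda>s. (L2_nrm M (V s))\<^sup>2"
  have S0: "0 \<le> S" by (simp add: S_def)
  have S1: "L2_nrm M (V 0) * L2_nrm M x0 \<le> S" "(L2_nrm M x0)\<^sup>2 \<le> S" by (auto simp: S_def)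
  have \<xi>_int: "set_integrable N {a..b} ?\<xi>" and v_int: "set_integrable N {a..b} ?v" for a b
    by (rule L2_process_nrm_set_integrable[OF xp] L2_process_nrm_set_integrable[OF Vp])+
  have D_int: "set_integrable N {a..b} D" if "0 \<le> a" "b \<le> T" for a b
    unfolding D_def
    by (rule set_integral_add(1)[OF integrable_inner_x[OF g that] integrable_inner_V[OF f that orth_f]])
  have v_mean: "\<alpha> * (LINT s:{0..r}|N. ?v s) \<le> S + L * (LINT s:{0..r}|N. ?\<xi> s)" if r: "r \<in> {0..T}" for r
  proof -
    have "\<alpha> * (LINT s:{0..r}|N. ?v s) - L * (LINT s:{0..r}|N. ?\<xi> s)
        = (LINT s:{0..r}|N. \<alpha> * ?v s - L * ?\<xi> s)"
      using v_int \<xi>_int by (simp add: set_integral_diff)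
    also have "\<dots> \<le> (LINT s:{0..r}|N. D s)"
    proof (rule set_integral_mono)
      show "set_integrable N {0..r} (\<lambda>s. \<alpha> * ?v s - L * ?\<xi> s)"
        using v_int \<xi>_int by (intro set_integral_diff(1) set_integrable_mult_right) auto
      show "set_integrable N {0..r} D" using r by (intro D_int) auto
      show "\<alpha> * ?v s - L * ?\<xi> s \<le> D s" if "s \<in> {0..r}" for s
        using strong[of s] r that by (simp add: D_def)
    qed
    also have "\<dots> \<le> (LINT s:{0..T}|N. D s)"
    proof (rule set_integral_mono_interval[OF D_int D_int])
      show "0 \<le> D s" if "s \<in> {0..T}" for s using mono[OF that] by (simp add: D_def)
    qed (use r in auto)
    also have "\<dots> \<le> L2_inner M (V 0) x0"
      using duality terminal unfolding D_def by simp
    also have "\<dots> \<le> L2_nrm M (V 0) * L2_nrm M x0"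
      using V[of 0] x0 T_nonneg by (intro L2_Cauchy_Schwarz) auto
    also have "\<dots> \<le> S" by (rule S1)
    finally show ?thesis by simp
  qed
  have forward: "?\<xi> r \<le> (1 + 2 * C / \<alpha>) * S + 2 * C * (1 + L / \<alpha>) * (LINT s:{0..r}|N. ?\<xi> s)"
    if r: "r \<in> {0..T}" for r
  proof -
    let ?X = "LINT s:{0..r}|N. ?\<xi> s" and ?Y = "LINT s:{0..r}|N. ?v s"
    have "- (C * (?X + ?Y)) = (LINT s:{0..r}|N. - C * (?\<xi> s + ?v s))"
      by (simp only: set_integral_mult_right set_integral_add(2)[OF \<xi>_int v_int])
    also have "\<dots> \<le> (LINT s:{0..r}|N. L2_inner M (f s) (x s))"
    proof (rule set_integral_mono)
      show "set_integrable N {0..r} (\<lambda>s. - C * (?\<xi> s + ?v s))"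
        using v_int \<xi>_int by (intro set_integrable_mult_right set_integral_add(1)) auto
      show "set_integrable N {0..r} (\<lambda>s. L2_inner M (f s) (x s))"
        using r by (intro integrable_inner_x[OF f]) auto
    qed (use r f_lower in auto)
    finally have "?\<xi> r \<le> (L2_nrm M x0)\<^sup>2 + 2 * (C * (?X + ?Y))"
      using forward_energy[OF r] by simp
    also have "\<dots> \<le> S + 2 * (C * (?X + (S + L * ?X) / \<alpha>))"
    proof -
      have "?Y \<le> (S + L * ?X) / \<alpha>" using v_mean[OF r] \<alpha> by (simp add: field_simps)
      then show ?thesis using C S1 by (intro add_mono mult_left_mono) auto
    qed
    also have "\<dots> = (1 + 2 * C / \<alpha>) * S + 2 * C * (1 + L / \<alpha>) * ?X"
      using \<alpha> by (simp add: field_simps)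
    finally show ?thesis .
  qed
  have \<xi>_le: "?\<xi> r \<le> K1 * S" if r: "r \<in> {0..T}" for r
  proof -
    have "?\<xi> r \<le> 2 * ((1 + 2 * C / \<alpha>) * S) * exp (2 * (2 * C * (1 + L / \<alpha>)) * T)"
    proof (rule Gronwall_integrable[OF _ _ _ _ _ r])
      show "set_integrable lborel {0..T} ?\<xi>"
        using \<xi>_int[of 0 T] by (simp add: set_integral_time_interval)
      show "0 < 2 * C * (1 + L / \<alpha>)" "0 \<le> (1 + 2 * C / \<alpha>) * S"
        using C \<alpha> L S0 by (auto intro!: mult_pos_pos add_pos_nonneg)
      show "?\<xi> r \<le> (1 + 2 * C / \<alpha>) * S + 2 * C * (1 + L / \<alpha>) * (LINT s:{0..r}|lborel. ?\<xi> s)"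
        if "r \<in> {0..T}" for r
        using forward[OF that] that by (simp add: set_integral_time_interval)
    qed simp
    then show ?thesis by (simp add: K1_def forward_const_def algebra_simps)
  qed
  then show "?\<xi> t \<le> forward_const C \<alpha> L T * S" using t by (simp add: K1_def)
  have K1: "1 \<le> K1" unfolding K1_def by (rule backward_const_ge(1)[OF C \<alpha> L T_nonneg])
  let ?Z = "max S (S powr \<gamma>)"
  have Z: "S \<le> ?Z" "0 \<le> ?Z" using S0 by auto
  have \<xi>_exp_le: "(L2_nrm_exp M \<gamma> (x r))\<^sup>2 \<le> K1 * ?Z" if r: "r \<in> {0..T}" for r
  proof -
    have "(L2_nrm_exp M \<gamma> (x r))\<^sup>2 = max (?\<xi> r) (?\<xi> r powr \<gamma>)"
      by (simp add: L2_nrm_exp_def max_powr_squared)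
    also have "\<dots> \<le> max (K1 * S) ((K1 * S) powr \<gamma>)"
      using \<xi>_le[OF r] \<gamma> by (intro max_powr_mono) auto
    also have "\<dots> \<le> K1 * ?Z" using K1 S0 \<gamma> by (rule max_powr_scale_le)
    finally show ?thesis .
  qed
  have v_total: "(LINT s:{0..T}|N. ?v s) \<le> (1 + L * T * K1) / \<alpha> * ?Z"
  proof -
    have "(LINT s:{0..T}|N. ?\<xi> s) \<le> (LINT s:{0..T}|N. K1 * S)"
      using \<xi>_le T_nonneg by (intro set_integral_mono \<xi>_int set_integrable_const) auto
    also have "\<dots> = T * (K1 * S)" using set_integral_const[of 0 T] T_nonneg by simp
    finally have "\<alpha> * (LINT s:{0..T}|N. ?v s) \<le> S + L * (T * (K1 * S))"
      using v_mean[of T] T_nonneg L by (smt (verit) atLeastAtMost_iff mult_left_mono)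
    also have "\<dots> = (1 + L * T * K1) * S" by (simp add: algebra_simps)
    also have "\<dots> \<le> (1 + L * T * K1) * ?Z"
      using L T_nonneg K1 Z by (intro mult_left_mono) auto
    finally show ?thesis using \<alpha> by (simp add: field_simps)
  qed
  have "(LINT s:{t..T}|N. L2_inner M (g s) (V s)) \<le> (LINT s:{t..T}|N. C * (K1 * ?Z + ?v s))"
  proof (rule set_integral_mono)
    show "set_integrable N {t..T} (\<lambda>s. L2_inner M (g s) (V s))"
      using t by (intro integrable_inner_V[OF g] orth_g) auto
    have "set_integrable N {t..T} (\<lambda>s. K1 * ?Z)"
      using t by (intro set_integrable_const) auto
    then show "set_integrable N {t..T} (\<lambda>s. C * (K1 * ?Z + ?v s))"
      using v_int by (intro set_integrable_mult_right set_integral_add(1)) auto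
    fix s assume "s \<in> {t..T}"
    then have s: "s \<in> {0..T}" using t by auto
    show "L2_inner M (g s) (V s) \<le> C * (K1 * ?Z + ?v s)"
      using g_upper[OF s] \<xi>_exp_le[OF s] C by (smt (verit) mult_left_mono)
  qed
  also have "\<dots> = C * ((T - t) * (K1 * ?Z) + (LINT s:{t..T}|N. ?v s))"
  proof -
    have "set_integrable N {t..T} (\<lambda>s. K1 * ?Z)"
      using t by (intro set_integrable_const) auto
    then have "(LINT s:{t..T}|N. K1 * ?Z + ?v s) = (T - t) * (K1 * ?Z) + (LINT s:{t..T}|N. ?v s)"
      using set_integral_add(2)[OF _ v_int] set_integral_const[of t T "K1 * ?Z"] t by simp
    then show ?thesis by simp
  qed
  also have "\<dots> \<le> C * (T * (K1 * ?Z) + (1 + L * T * K1) / \<alpha> * ?Z)"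
  proof (intro mult_left_mono add_mono mult_right_mono)
    show "(LINT s:{t..T}|N. ?v s) \<le> (1 + L * T * K1) / \<alpha> * ?Z"
      using set_integral_mono_interval[OF v_int v_int, of 0 t T T] v_total t by simp
  qed (use t C K1 Z in auto)
  finally have main: "(LINT s:{t..T}|N. L2_inner M (g s) (V s))
      \<le> C * (T * (K1 * ?Z) + (1 + L * T * K1) / \<alpha> * ?Z)" .
  have "(L2_nrm M h)\<^sup>2 \<le> (C * L2_nrm_exp M \<gamma> (x T))\<^sup>2"
    using h_le by (intro power_mono) auto
  also have "\<dots> \<le> C\<^sup>2 * (K1 * ?Z)"
    using \<xi>_exp_le[of T] T_nonneg by (simp add: power_mult_distrib mult_left_mono)
  finally have "?v t \<le> C\<^sup>2 * (K1 * ?Z) + 2 * (C * (T * (K1 * ?Z) + (1 + L * T * K1) / \<alpha> * ?Z))"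
    using backward_energy[OF t] main by linarith
  also have "\<dots> = backward_const C \<alpha> L T * ?Z"
    by (simp add: backward_const_def Let_def flip: K1_def) (simp add: algebra_simps)
  finally show "?v t \<le> backward_const C \<alpha> L T * ?Z" .
qed

end

section \<open>Orthogonality of the Ito integral\<close>

text \<open>A centred variable that is independent of a $\sigma$-algebra is orthogonal to everything measurable
  with respect to it.\<close>

lemma (in prob_space) centred_indep_orthogonal:
  fixes D \<zeta> :: "'a \<Rightarrow> real"
  assumes \<F>: "subalgebra M \<F>"
    and ind: "indep_set (sets \<F>) {D -` A \<inter> space M | A. A \<in> sets borel}"
    and D: "integrable M D" "expectation D = 0"
    and \<zeta>: "\<zeta> \<in> borel_measurable \<F>" "integrable M \<zeta>"
  shows "expectation (\<lambda>\<omega>. \<zeta> \<omega> * D \<omega>) = 0"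
proof -
  have sp: "space \<F> = space M" and sub: "sets \<F> \<subseteq> sets M"
    using \<F> by (auto simp: subalgebra_def)
  have "indep_var borel \<zeta> borel D"
    unfolding indep_var_eq
  proof (intro conjI)
    show "random_variable borel \<zeta>" "random_variable borel D" using D \<zeta> by auto
    show "indep_set (sigma_sets (space M) {\<zeta> -` A \<inter> space M |A. A \<in> sets borel})
        (sigma_sets (space M) {D -` A \<inter> space M |A. A \<in> sets borel})"
    proof (rule indep_set_sigma_sets)
      show "indep_set {\<zeta> -` A \<inter> space M |A. A \<in> sets borel} {D -` A \<inter> space M |A. A \<in> sets borel}"
        using ind measurable_sets[OF \<zeta>(1)] unfolding indep_sets2_eq sp by blast
      have "Int_stable {X -` A \<inter> space M |A. A \<in> sets borel}" for X :: "'a \<Rightarrow> real"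
      proof (rule Int_stableI)
        fix a b assume "a \<in> {X -` A \<inter> space M |A. A \<in> sets borel}" "b \<in> {X -` A \<inter> space M |A. A \<in> sets borel}"
        then obtain A B where "A \<in> sets borel" "B \<in> sets borel" "a = X -` A \<inter> space M" "b = X -` B \<inter> space M"
          by auto
        then show "a \<inter> b \<in> {X -` A \<inter> space M |A. A \<in> sets borel}"
          by (intro CollectI exI[of _ "A \<inter> B"]) auto
      qed
      then show "Int_stable {\<zeta> -` A \<inter> space M |A. A \<in> sets borel}"
        "Int_stable {D -` A \<inter> space M |A. A \<in> sets borel}" by auto
    qed
  qed
  from indep_var_lebesgue_integral[OF this \<zeta>(2) D(1)] D(2) show ?thesis by simp
qed

lemma borel_measurable_vec_nth [measurable]:
  "(\<lambda>x :: ('b::topological_space)^'n. x $ i) \<in> borel_measurable borel"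
  by (rule borel_measurable_continuous_onI) (intro continuous_intros)

lemma brownian_increment:
  fixes B :: "real \<Rightarrow> 'a \<Rightarrow> real^'n"
  assumes M: "prob_space M" and \<F>: "sub_filtration M \<F>" and B: "brownian_motion M \<F> T B"
    and st: "0 \<le> s" "s \<le> t" "t \<le> T"
  shows "(\<lambda>\<omega>. B t \<omega> - B s \<omega>) \<in> L2_rv M"
    and "\<zeta> \<in> borel_measurable (\<F> s) \<Longrightarrow> integrable M \<zeta> \<Longrightarrow>
      (\<integral>\<omega>. \<zeta> \<omega> * (B t \<omega> - B s \<omega>) $ i \<partial>M) = 0"
proof -
  interpret prob_space M by fact
  have sub: "subalgebra M (\<F> r)" for r using \<F> by (simp add: sub_filtration_def)
  have meas [measurable]: "B r \<in> borel_measurable M" if "0 \<le> r" "r \<le> T" for r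
    using B that by (intro measurable_from_subalg[OF sub]) (auto simp: brownian_motion_def)
  have Bm [measurable]: "B s \<in> borel_measurable M" "B t \<in> borel_measurable M"
    using meas st by auto
  have distr: "distributed M lborel (\<lambda>\<omega>. (B t \<omega> - B s \<omega>) $ j) (normal_density 0 (sqrt (t - s)))"
    and ind: "indep_set (sets (\<F> s)) {(\<lambda>\<omega>. B t \<omega> - B s \<omega>) -` A \<inter> space M | A. A \<in> sets borel}"
    if "s < t" for j
    using B st that unfolding brownian_motion_def by auto
  have sq: "integrable M (\<lambda>\<omega>. ((B t \<omega> - B s \<omega>) $ j)\<^sup>2)" for j
  proof (cases "s < t")
    case True
    have "integrable lborel (\<lambda>x. normal_density 0 (sqrt (t - s)) x * (x - 0)\<^sup>2)"
      by (rule integrable_normal_moment) (use True in simp)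
    then show ?thesis
      using distributed_integrable[OF distr[OF True], of "\<lambda>x. x\<^sup>2"] by simp
  qed (use st in simp)
  have "(norm v)\<^sup>2 = (\<Sum>j\<in>UNIV. (v $ j)\<^sup>2)" for v :: "real^'n"
    by (simp add: norm_vec_def L2_set_def sum_nonneg)
  with sq show D: "(\<lambda>\<omega>. B t \<omega> - B s \<omega>) \<in> L2_rv M"
    by (simp add: L2_rv_def)
  assume \<zeta>: "\<zeta> \<in> borel_measurable (\<F> s)" "integrable M \<zeta>"
  show "(\<integral>\<omega>. \<zeta> \<omega> * (B t \<omega> - B s \<omega>) $ i \<partial>M) = 0"
  proof (cases "s < t")
    case True
    show ?thesis
    proof (rule centred_indep_orthogonal[OF sub _ _ _ \<zeta>])
      show "indep_set (sets (\<F> s)) {(\<lambda>\<omega>. (B t \<omega> - B s \<omega>) $ i) -` A \<inter> space M | A. A \<in> sets borel}"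
        unfolding indep_sets2_eq
      proof (intro conjI ballI)
        fix a b assume a: "a \<in> sets (\<F> s)"
          and "b \<in> {(\<lambda>\<omega>. (B t \<omega> - B s \<omega>) $ i) -` A \<inter> space M | A. A \<in> sets borel}"
        then obtain A where A: "A \<in> sets borel" "b = (\<lambda>\<omega>. (B t \<omega> - B s \<omega>) $ i) -` A \<inter> space M"
          by auto
        then have "b = (\<lambda>\<omega>. B t \<omega> - B s \<omega>) -` ((\<lambda>v. v $ i) -` A) \<inter> space M" by auto
        moreover have "(\<lambda>v::real^'n. v $ i) -` A \<in> sets borel"
          using measurable_sets[of "\<lambda>v::real^'n. v $ i" borel borel A] A by simp
        ultimately show "prob (a \<inter> b) = prob a * prob b"
          using ind[OF True] a unfolding indep_sets2_eq by blast
      next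
        show "sets (\<F> s) \<subseteq> events" using sub[of s] by (simp add: subalgebra_def)
        show "{(\<lambda>\<omega>. (B t \<omega> - B s \<omega>) $ i) -` A \<inter> space M | A. A \<in> sets borel} \<subseteq> events"
        proof safe
          fix A :: "real set" assume [measurable]: "A \<in> sets borel"
          show "(\<lambda>\<omega>. (B t \<omega> - B s \<omega>) $ i) -` A \<inter> space M \<in> events" by measurable
        qed
      qed
      show "integrable M (\<lambda>\<omega>. (B t \<omega> - B s \<omega>) $ i)"
        by (rule square_integrable_imp_integrable[OF _ sq]) measurable
      show "expectation (\<lambda>\<omega>. (B t \<omega> - B s \<omega>) $ i) = 0"
        by (rule normal_distributed_expectation[OF _ distr[OF True]]) (use True in simp)
    qed
  qed (use st in simp)
qed

lemma norm_matrix_vector_le: "norm (A *v x) \<le> norm A * norm x" for A :: "real^'n^'m"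
proof -
  have "(norm (A *v x))\<^sup>2 = (\<Sum>i\<in>UNIV. (A $ i \<bullet> x)\<^sup>2)"
    by (simp add: norm_vec_def L2_set_def sum_nonneg matrix_vector_mul_component)
  also have "\<dots> \<le> (\<Sum>i\<in>UNIV. (norm (A $ i))\<^sup>2 * (norm x)\<^sup>2)"
    by (intro sum_mono) (metis Cauchy_Schwarz_ineq power2_norm_eq_inner)
  also have "\<dots> = (norm A * norm x)\<^sup>2"
    by (simp add: norm_vec_def[of A] L2_set_def sum_nonneg power_mult_distrib sum_distrib_right)
  finally show ?thesis by (rule power2_le_imp_le) simp
qed

text \<open>On each step, the product of $c$ with an entry of the coefficient is known at time $\tau_k$, while
  the increment of $B$ after $\tau_k$ is centred and independent of that past.\<close>

lemma simple_integral_orthogonal: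
  fixes B :: "real \<Rightarrow> 'a \<Rightarrow> real^'n"
  assumes M: "prob_space M" and \<F>: "sub_filtration M \<F>" and B: "brownian_motion M \<F> T B"
    and t: "0 \<le> a" "b \<le> T"
    and simple: "simple_process M \<F> a b m \<tau> \<xi>"
    and c: "c \<in> L2_rv M" "c \<in> borel_measurable (\<F> a)"
  shows "simple_integral B m \<tau> \<xi> \<in> L2_rv M" "L2_inner M c (simple_integral B m \<tau> \<xi>) = 0"
proof -
  interpret prob_space M by fact
  have sub: "subalgebra M (\<F> r)" for r using \<F> by (simp add: sub_filtration_def)
  have step: "\<tau> k \<le> \<tau> (Suc k)" if "k < m" for k
    using simple that by (simp add: simple_process_def)
  have lo: "a \<le> \<tau> k" if "k \<le> m" for k
    using that by (induction k) (use simple step in \<open>auto simp: simple_process_def intro: order_trans\<close>)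
  \<comment> \<open>Downward from the right end point, since the times increase only up to index $m$.\<close>
  have hi: "\<tau> (m - j) \<le> b" for j
  proof (induction j)
    case (Suc j)
    then show ?case using step[of "m - Suc j"]
      by (cases "j < m") (auto simp: Suc_diff_Suc)
  qed (use simple in \<open>simp add: simple_process_def\<close>)
  have hi: "\<tau> k \<le> b" if "k \<le> m" for k using hi[of "m - k"] that by simp
  let ?D = "\<lambda>k \<omega>. B (\<tau> (Suc k)) \<omega> - B (\<tau> k) \<omega>"
  have piece: "(\<lambda>\<omega>. \<xi> k \<omega> *v ?D k \<omega>) \<in> L2_rv M \<and> L2_inner M c (\<lambda>\<omega>. \<xi> k \<omega> *v ?D k \<omega>) = 0"
    if k: "k < m" for k
  proof -
    have order: "0 \<le> \<tau> k" "\<tau> k \<le> \<tau> (Suc k)" "\<tau> (Suc k) \<le> T"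
      using lo[of k] hi[of "Suc k"] step[OF k] k t by auto
    have \<xi>\<F>: "\<xi> k \<in> borel_measurable (\<F> (\<tau> k))"
      using simple k by (simp add: simple_process_def)
    then have \<xi>M [measurable]: "\<xi> k \<in> borel_measurable M" by (rule measurable_from_subalg[OF sub])
    obtain K where K: "\<And>\<omega>. \<omega> \<in> space M \<Longrightarrow> norm (\<xi> k \<omega>) \<le> K"
      using simple k unfolding simple_process_def by blast
    note D = brownian_increment(1)[OF M \<F> B order]
    have [measurable]: "?D k \<in> borel_measurable M" "c \<in> borel_measurable M" using D c by measurable
    have entry: "\<bar>\<xi> k \<omega> $ i $ j\<bar> \<le> K" if "\<omega> \<in> space M" for i j \<omega>
    proof -
      have "\<bar>\<xi> k \<omega> $ i $ j\<bar> \<le> norm (\<xi> k \<omega> $ i)" by (rule component_le_norm_cart)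
      also have "\<dots> \<le> norm (\<xi> k \<omega>)" by (rule Finite_Cartesian_Product.norm_nth_le)
      finally show ?thesis using K[OF that] by simp
    qed
    have cF: "c \<in> borel_measurable (\<F> (\<tau> k))"
    proof (rule measurable_from_subalg[OF _ c(2)])
      show "subalgebra (\<F> (\<tau> k)) (\<F> a)"
        using \<F> lo[of k] k by (auto simp: sub_filtration_def filtration_def subalgebra_def)
    qed
    have AD [measurable]: "(\<lambda>\<omega>. \<xi> k \<omega> *v ?D k \<omega>) \<in> borel_measurable M"
      by (rule borel_measurable_continuous_Pair[where H = "\<lambda>A v. A *v v"])
         (auto simp: matrix_vector_mult_def intro!: continuous_intros)
    have "(norm (\<xi> k \<omega> *v ?D k \<omega>))\<^sup>2 \<le> K\<^sup>2 * (norm (?D k \<omega>))\<^sup>2" if "\<omega> \<in> space M" for \<omega>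
    proof -
      have "norm (\<xi> k \<omega> *v ?D k \<omega>) \<le> K * norm (?D k \<omega>)"
        by (rule order_trans[OF norm_matrix_vector_le]) (use K[OF that] in \<open>simp add: mult_right_mono\<close>)
      from power_mono[OF this norm_ge_zero, of 2] show ?thesis by (simp add: power_mult_distrib)
    qed
    then have L2: "(\<lambda>\<omega>. \<xi> k \<omega> *v ?D k \<omega>) \<in> L2_rv M"
      using L2_rv_norm_squared_integrable[OF D] by (intro L2_rvI_bound[OF AD, where u = "\<lambda>\<omega>. K\<^sup>2 * (norm (?D k \<omega>))\<^sup>2"] AE_I2) auto
    have coeff: "(\<lambda>\<omega>. c \<omega> $ i * \<xi> k \<omega> $ i $ j) \<in> L2_rv M" for i j
    proof (rule L2_rvI_bound)
      show "integrable M (\<lambda>\<omega>. K\<^sup>2 * (norm (c \<omega>))\<^sup>2)"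
        using L2_rv_norm_squared_integrable[OF c(1)] by simp
      show "AE \<omega> in M. (norm (c \<omega> $ i * \<xi> k \<omega> $ i $ j))\<^sup>2 \<le> K\<^sup>2 * (norm (c \<omega>))\<^sup>2"
      proof (rule AE_I2)
        fix \<omega> assume "\<omega> \<in> space M"
        then have "\<bar>\<xi> k \<omega> $ i $ j\<bar> * \<bar>c \<omega> $ i\<bar> \<le> K * norm (c \<omega>)"
          using entry[of \<omega> i j] by (intro mult_mono component_le_norm_cart) auto
        then have "\<bar>c \<omega> $ i * \<xi> k \<omega> $ i $ j\<bar>\<^sup>2 \<le> (K * norm (c \<omega>))\<^sup>2"
          by (intro power_mono) (auto simp: abs_mult mult.commute)
        then show "(norm (c \<omega> $ i * \<xi> k \<omega> $ i $ j))\<^sup>2 \<le> K\<^sup>2 * (norm (c \<omega>))\<^sup>2"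
          by (simp add: power_mult_distrib)
      qed
    qed measurable
    have Dj: "(\<lambda>\<omega>. ?D k \<omega> $ j) \<in> L2_rv M" for j
    proof (rule L2_rvI_bound[OF _ L2_rv_norm_squared_integrable[OF D]])
      show "AE \<omega> in M. (norm (?D k \<omega> $ j))\<^sup>2 \<le> (norm (?D k \<omega>))\<^sup>2"
        by (intro AE_I2 power_mono Finite_Cartesian_Product.norm_nth_le) auto
    qed measurable
    have "c \<omega> \<bullet> (\<xi> k \<omega> *v ?D k \<omega>)
        = (\<Sum>i\<in>UNIV. \<Sum>j\<in>UNIV. (c \<omega> $ i * \<xi> k \<omega> $ i $ j) * ?D k \<omega> $ j)" for \<omega>
      unfolding inner_vec_def matrix_vector_mult_def inner_real_def vec_lambda_beta sum_distrib_left mult.assoc ..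
    then have "L2_inner M c (\<lambda>\<omega>. \<xi> k \<omega> *v ?D k \<omega>)
        = (\<integral>\<omega>. (\<Sum>i\<in>UNIV. \<Sum>j\<in>UNIV. (c \<omega> $ i * \<xi> k \<omega> $ i $ j) * ?D k \<omega> $ j) \<partial>M)"
      by (simp only: L2_inner_def)
    also have "\<dots> = (\<Sum>i\<in>UNIV. \<Sum>j\<in>UNIV. \<integral>\<omega>. (c \<omega> $ i * \<xi> k \<omega> $ i $ j) * ?D k \<omega> $ j \<partial>M)"
    proof -
      have "integrable M (\<lambda>\<omega>. (c \<omega> $ i * \<xi> k \<omega> $ i $ j) * ?D k \<omega> $ j)" for i j
        using L2_inner_integrable[OF coeff Dj] by (simp only: inner_real_def)
      then show ?thesis
        by (subst Bochner_Integration.integral_sum Bochner_Integration.integral_sum, simp)+ simp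
    qed
    also have "\<dots> = 0"
    proof (intro sum.neutral ballI brownian_increment(2)[OF M \<F> B order])
      note [measurable] = cF \<xi>\<F>
      show "(\<lambda>\<omega>. c \<omega> $ i * \<xi> k \<omega> $ i $ j) \<in> borel_measurable (\<F> (\<tau> k))" for i j by measurable
      show "integrable M (\<lambda>\<omega>. c \<omega> $ i * \<xi> k \<omega> $ i $ j)" for i j by (rule L2_rv_integrable[OF coeff])
    qed
    finally have "L2_inner M c (\<lambda>\<omega>. \<xi> k \<omega> *v ?D k \<omega>) = 0" .
    with L2 show ?thesis by simp
  qed
  have eq: "simple_integral B m \<tau> \<xi> = (\<lambda>\<omega>. \<Sum>k<m. \<xi> k \<omega> *v ?D k \<omega>)"
    by (simp add: simple_integral_def fun_eq_iff)
  have "(\<lambda>\<omega>. \<Sum>k<n. \<xi> k \<omega> *v ?D k \<omega>) \<in> L2_rv M \<and>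
      L2_inner M c (\<lambda>\<omega>. \<Sum>k<n. \<xi> k \<omega> *v ?D k \<omega>) = 0" if "n \<le> m" for n
    using that
  proof (induction n)
    case 0
    then show ?case by (simp add: L2_rv_const L2_inner_def)
  next
    case (Suc n)
    with piece[of n] c(1) show ?case by (auto simp: L2_inner_add_right)
  qed
  then show "simple_integral B m \<tau> \<xi> \<in> L2_rv M" "L2_inner M c (simple_integral B m \<tau> \<xi>) = 0"
    unfolding eq by auto
qed

text \<open>Orthogonality to $c$ survives the mean square limit that defines the Ito integral.\<close>

lemma ito_integral_orthogonal:
  fixes B :: "real \<Rightarrow> 'a \<Rightarrow> real^'n"
  assumes M: "prob_space M" and \<F>: "sub_filtration M \<F>" and B: "brownian_motion M \<F> T B"
    and t: "0 \<le> a" "b \<le> T" and I: "has_ito_integral M \<F> B a b Z I"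
    and c: "c \<in> L2_rv M" "c \<in> borel_measurable (\<F> a)"
  shows "L2_inner M c I = 0"
proof -
  interpret prob_space M by fact
  obtain m \<tau> \<xi> where simple: "\<And>n. simple_process M \<F> a b (m n) (\<tau> n) (\<xi> n)"
    and lim: "(\<lambda>n. \<integral>\<^sup>+\<omega>. ennreal ((norm (simple_integral B (m n) (\<tau> n) (\<xi> n) \<omega> - I \<omega>))\<^sup>2) \<partial>M)
      \<longlonglongrightarrow> 0"
    using I unfolding has_ito_integral_def by blast
  have IL2: "I \<in> L2_rv M" using I by (simp add: has_ito_integral_def)
  let ?J = "\<lambda>n. simple_integral B (m n) (\<tau> n) (\<xi> n)"
  note J = simple_integral_orthogonal[OF M \<F> B t simple c]
  have diff: "(\<lambda>\<omega>. ?J n \<omega> - I \<omega>) \<in> L2_rv M" for n using J(1) IL2 by auto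
  have "(\<lambda>n. ennreal ((L2_nrm M (\<lambda>\<omega>. ?J n \<omega> - I \<omega>))\<^sup>2)) \<longlonglongrightarrow> ennreal 0"
    using lim nn_integral_eq_integral[OF L2_rv_norm_squared_integrable[OF diff]]
    by (simp add: L2_nrm_squared L2_inner_self)
  then have "(\<lambda>n. (L2_nrm M (\<lambda>\<omega>. ?J n \<omega> - I \<omega>))\<^sup>2) \<longlonglongrightarrow> 0"
    by (subst (asm) tendsto_ennreal_iff) auto
  then have "(\<lambda>n. L2_nrm M (\<lambda>\<omega>. ?J n \<omega> - I \<omega>)) \<longlonglongrightarrow> 0"
    using tendsto_real_sqrt by fastforce
  then have "(\<lambda>n. L2_nrm M c * L2_nrm M (\<lambda>\<omega>. ?J n \<omega> - I \<omega>)) \<longlonglongrightarrow> 0"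
    by (rule tendsto_mult_right_zero)
  moreover have "\<bar>L2_inner M c I\<bar> \<le> L2_nrm M c * L2_nrm M (\<lambda>\<omega>. ?J n \<omega> - I \<omega>)" for n
    using L2_Cauchy_Schwarz_abs[OF c(1) diff[of n]] J[of n] c(1) IL2
    by (simp add: L2_inner_diff_right)
  ultimately have "\<bar>L2_inner M c I\<bar> \<le> 0"
    by (intro LIMSEQ_le_const) auto
  then show ?thesis by simp
qed

section \<open>Square integrability of the lifts\<close>

text \<open>The diagonal coupling has no transport cost. This is what makes continuity in the joint sense of
  \<open>continuous_P2\<close> imply continuity in the point at a fixed measure.\<close>

lemma W2_self:
  assumes \<mu>: "\<mu> \<in> P2"
  shows "W2 \<mu> \<mu> = 0"
proof -
  interpret prob_space \<mu> using \<mu> by (simp add: P2_def)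
  have sets [measurable_cong]: "sets \<mu> = sets borel" using \<mu> by (simp add: P2_def)
  define \<delta> where "\<delta> = distr \<mu> (borel \<Otimes>\<^sub>M borel) (\<lambda>x. (x, x))"
  have \<delta>: "\<delta> \<in> couplings \<mu> \<mu>"
  proof -
    have "distr \<delta> borel fst = \<mu>" "distr \<delta> borel snd = \<mu>"
      unfolding \<delta>_def by (subst distr_distr; simp add: comp_def sets distr_id2)+
    moreover have "prob_space \<delta>" unfolding \<delta>_def by (rule prob_space_distr) measurable
    ultimately show ?thesis by (simp add: couplings_def \<delta>_def)
  qed
  have "(INF \<pi> \<in> couplings \<mu> \<mu>. \<integral>p. (dist (fst p) (snd p))\<^sup>2 \<partial>\<pi>)
      \<le> (\<integral>p. (dist (fst p) (snd p))\<^sup>2 \<partial>\<delta>)"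
    by (intro cINF_lower \<delta> bdd_belowI2[of _ 0]) simp
  also have "\<dots> = 0"
    unfolding \<delta>_def by (subst integral_distr) auto
  finally have "(INF \<pi> \<in> couplings \<mu> \<mu>. \<integral>p. (dist (fst p) (snd p))\<^sup>2 \<partial>\<pi>) \<le> 0" .
  moreover have "0 \<le> (INF \<pi> \<in> couplings \<mu> \<mu>. \<integral>p. (dist (fst p) (snd p))\<^sup>2 \<partial>\<pi>)"
    using \<delta> by (intro cINF_greatest) auto
  ultimately show ?thesis by (simp add: W2_def)
qed

lemma continuous_P2_imp_continuous_on:
  assumes f: "continuous_P2 f" and \<mu>: "\<mu> \<in> P2"
  shows "continuous_on UNIV (\<lambda>x. f x \<mu>)"
  unfolding continuous_on_iff
proof (intro ballI allI impI)
  fix x :: 'a and \<epsilon> :: real assume "0 < \<epsilon>"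
  then obtain \<delta> where "0 < \<delta>"
    and "\<And>y \<nu>. \<nu> \<in> P2 \<Longrightarrow> dist y x < \<delta> \<Longrightarrow> W2 \<nu> \<mu> < \<delta> \<Longrightarrow> dist (f y \<nu>) (f x \<mu>) < \<epsilon>"
    using f \<mu> unfolding continuous_P2_def by meson
  with W2_self[OF \<mu>] \<mu> show "\<exists>\<delta>>0. \<forall>y\<in>UNIV. dist y x < \<delta> \<longrightarrow> dist (f y \<mu>) (f x \<mu>) < \<epsilon>"
    by (intro exI[of _ \<delta>]) auto
qed

lemma continuous_P2_measurable:
  fixes f :: "'x::{metric_space, second_countable_topology} \<Rightarrow> 'b::euclidean_space measure \<Rightarrow> 'c::metric_space"
  assumes "continuous_P2 f" "\<mu> \<in> P2" "X \<in> borel_measurable A"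
  shows "(\<lambda>\<omega>. f (X \<omega>) \<mu>) \<in> borel_measurable A"
  by (rule measurable_compose[OF assms(3) borel_measurable_continuous_onI])
     (rule continuous_P2_imp_continuous_on[OF assms(1,2)])

lemma (in prob_space) law_in_P2:
  assumes X: "X \<in> L2_rv M"
  shows "distr M borel X \<in> P2" and "E2 (distr M borel X) = L2_inner M X X"
proof -
  have [measurable]: "X \<in> borel_measurable M" using X by measurable
  show "distr M borel X \<in> P2"
    using L2_rv_norm_squared_integrable[OF X]
    by (simp add: P2_def prob_space_distr integrable_distr_eq)
  show "E2 (distr M borel X) = L2_inner M X X"
    by (simp add: E2_def L2_inner_self integral_distr)
qed

lemma lift_measurable:
  fixes F :: "'b::euclidean_space \<Rightarrow> 'b measure \<Rightarrow> 'b \<Rightarrow> 'b"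
  assumes M: "prob_space M" and F: "continuous_P2 (\<lambda>(x, u) \<mu>. F x \<mu> u)"
    and X: "X \<in> L2_rv M" and A: "X \<in> borel_measurable A" "U \<in> borel_measurable A"
  shows "lift M F X U \<in> borel_measurable A"
proof -
  have "(\<lambda>\<omega>. (X \<omega>, U \<omega>)) \<in> borel_measurable A" using A by (rule borel_measurable_Pair)
  from continuous_P2_measurable[OF F prob_space.law_in_P2(1)[OF M X] this]
  show ?thesis by (simp add: lift_def[abs_def])
qed

lemma norm_lift_squared_le:
  fixes F :: "'b::euclidean_space \<Rightarrow> 'b measure \<Rightarrow> 'b \<Rightarrow> 'b"
  assumes M: "prob_space M" and X: "X \<in> L2_rv M"
    and F: "\<And>x \<mu> u. \<mu> \<in> P2 \<Longrightarrow> norm (F x \<mu> u) \<le> C * (1 + norm x + norm u + sqrt (E2 \<mu>))"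
  shows "(norm (lift M F X U \<omega>))\<^sup>2
    \<le> 4 * C\<^sup>2 * (1 + (norm (X \<omega>))\<^sup>2 + (norm (U \<omega>))\<^sup>2 + L2_inner M X X)"
proof -
  have sum4: "(1 + p + q + r)\<^sup>2 \<le> 4 * (1 + p\<^sup>2 + q\<^sup>2 + r\<^sup>2)" for p q r :: real
  proof -
    have "4 * (1 + p\<^sup>2 + q\<^sup>2 + r\<^sup>2) - (1 + p + q + r)\<^sup>2
        = (1 - p)\<^sup>2 + (1 - q)\<^sup>2 + (1 - r)\<^sup>2 + (p - q)\<^sup>2 + (p - r)\<^sup>2 + (q - r)\<^sup>2"
      by (simp add: power2_eq_square algebra_simps)
    also have "\<dots> \<ge> 0" by simp
    finally show ?thesis by simp
  qed
  have "norm (lift M F X U \<omega>) \<le> C * (1 + norm (X \<omega>) + norm (U \<omega>) + L2_nrm M X)"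
    using F[OF prob_space.law_in_P2(1)[OF M X], of "X \<omega>" "U \<omega>"]
    by (simp add: lift_def L2_nrm_def prob_space.law_in_P2(2)[OF M X])
  then have "(norm (lift M F X U \<omega>))\<^sup>2 \<le> (C * (1 + norm (X \<omega>) + norm (U \<omega>) + L2_nrm M X))\<^sup>2"
    by (intro power_mono) auto
  also have "\<dots> = C\<^sup>2 * (1 + norm (X \<omega>) + norm (U \<omega>) + L2_nrm M X)\<^sup>2"
    by (rule power_mult_distrib)
  also have "\<dots> \<le> C\<^sup>2 * (4 * (1 + (norm (X \<omega>))\<^sup>2 + (norm (U \<omega>))\<^sup>2 + (L2_nrm M X)\<^sup>2))"
    by (rule mult_left_mono[OF sum4]) simp
  finally show ?thesis
    by (simp only: L2_nrm_squared mult.assoc mult.left_commute[of 4])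
qed

lemma lift_L2:
  fixes F :: "'b::euclidean_space \<Rightarrow> 'b measure \<Rightarrow> 'b \<Rightarrow> 'b"
  assumes M: "prob_space M" and F: "continuous_P2 (\<lambda>(x, u) \<mu>. F x \<mu> u)"
    and growth: "\<And>x \<mu> u. \<mu> \<in> P2 \<Longrightarrow> norm (F x \<mu> u) \<le> C * (1 + norm x + norm u + sqrt (E2 \<mu>))"
    and X: "X \<in> L2_rv M" and U: "U \<in> L2_rv M"
  shows "lift M F X U \<in> L2_rv M"
proof (rule L2_rvI_bound)
  interpret prob_space M by fact
  show "lift M F X U \<in> borel_measurable M"
    by (rule lift_measurable[OF M F X]) (use X U in measurable)
  show "AE \<omega> in M. (norm (lift M F X U \<omega>))\<^sup>2
    \<le> 4 * C\<^sup>2 * (1 + (norm (X \<omega>))\<^sup>2 + (norm (U \<omega>))\<^sup>2 + L2_inner M X X)"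
    by (intro AE_I2 norm_lift_squared_le[OF M X] growth)
  show "integrable M (\<lambda>\<omega>. 4 * C\<^sup>2 * (1 + (norm (X \<omega>))\<^sup>2 + (norm (U \<omega>))\<^sup>2 + L2_inner M X X))"
    using X U by (simp add: L2_rv_norm_squared_integrable)
qed

lemma lift0_eq_lift: "lift0 M W0 X = lift M (\<lambda>x \<mu> u. W0 x \<mu>) X X"
  by (simp add: lift_def lift0_def fun_eq_iff)

text \<open>The dependence on the law contributes $\|X_s\|^2$ to the growth bound, a function of time alone that is
  integrable because $X$ is square integrable on the product.\<close>

lemma (in time_randomness) lift_L2_process:
  fixes F :: "'c::euclidean_space \<Rightarrow> 'c measure \<Rightarrow> 'c \<Rightarrow> 'c"
  assumes F: "continuous_P2 (\<lambda>(x, u) \<mu>. F x \<mu> u)"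
    and growth: "\<And>x \<mu> u. \<mu> \<in> P2 \<Longrightarrow> norm (F x \<mu> u) \<le> C * (1 + norm x + norm u + sqrt (E2 \<mu>))"
    and X: "L2_process N M X" and U: "L2_process N M U"
    and meas: "(\<lambda>(s, \<omega>). lift M F (X s) (U s) \<omega>) \<in> borel_measurable (N \<Otimes>\<^sub>M M)"
  shows "L2_process N M (\<lambda>s. lift M F (X s) (U s))"
  unfolding L2_process_def
proof (intro conjI ballI)
  show "lift M F (X s) (U s) \<in> L2_rv M" if "s \<in> space N" for s
    using L2_processD(2)[OF X that] L2_processD(2)[OF U that]
    by (intro lift_L2[OF M.prob_space_axioms F growth])
  show "(\<lambda>(s, \<omega>). lift M F (X s) (U s) \<omega>) \<in> L2_rv (N \<Otimes>\<^sub>M M)"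
  proof (rule L2_rvI_bound[OF meas])
    note [measurable] = borel_measurable_integrable[OF L2_process_norm_integrable[OF X]]
    have "integrable (N \<Otimes>\<^sub>M M) (\<lambda>p. L2_inner M (X (fst p)) (X (fst p)))"
      by (rule Fubini_integrable) (use L2_process_norm_integrable[OF X] in auto)
    then show "integrable (N \<Otimes>\<^sub>M M) (\<lambda>p. 4 * C\<^sup>2 * (1 + (norm (case_prod X p))\<^sup>2
        + (norm (case_prod U p))\<^sup>2 + L2_inner M (X (fst p)) (X (fst p))))"
      using L2_rv_norm_squared_integrable[OF L2_processD(1)[OF X]]
        L2_rv_norm_squared_integrable[OF L2_processD(1)[OF U]] by simp
    show "AE p in N \<Otimes>\<^sub>M M. (norm (case p of (s, \<omega>) \<Rightarrow> lift M F (X s) (U s) \<omega>))\<^sup>2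
      \<le> 4 * C\<^sup>2 * (1 + (norm (case_prod X p))\<^sup>2
        + (norm (case_prod U p))\<^sup>2 + L2_inner M (X (fst p)) (X (fst p)))"
    proof (rule AE_I2)
      fix p assume "p \<in> space (N \<Otimes>\<^sub>M M)"
      then obtain s \<omega> where p: "p = (s, \<omega>)" and s: "s \<in> space N" by (auto simp: space_pair_measure)
      show "(norm (case p of (s, \<omega>) \<Rightarrow> lift M F (X s) (U s) \<omega>))\<^sup>2
        \<le> 4 * C\<^sup>2 * (1 + (norm (case_prod X p))\<^sup>2
          + (norm (case_prod U p))\<^sup>2 + L2_inner M (X (fst p)) (X (fst p)))"
        using norm_lift_squared_le[OF M.prob_space_axioms L2_processD(2)[OF X s] growth, where U = "U s"]
        by (simp add: p)
    qed
  qed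
qed

section \<open>Stability of strong solutions\<close>

lemma continuous_P2_fst:
  assumes "continuous_P2 f"
  shows "continuous_P2 (\<lambda>(x, u) \<mu>. f x \<mu>)"
  unfolding continuous_P2_def
proof (intro allI ballI impI)
  fix p :: "'a \<times> 'd" and \<mu> :: "'b measure" and \<epsilon> :: real
  assume "\<mu> \<in> P2" "0 < \<epsilon>"
  then obtain \<delta> where "0 < \<delta>" and \<delta>: "\<And>y \<nu>. \<nu> \<in> P2 \<Longrightarrow> dist y (fst p) < \<delta> \<Longrightarrow> W2 \<nu> \<mu> < \<delta> \<Longrightarrow>
      dist (f y \<nu>) (f (fst p) \<mu>) < \<epsilon>"
    using assms unfolding continuous_P2_def by meson
  have "dist (f (fst q) \<nu>) (f (fst p) \<mu>) < \<epsilon>"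
    if "\<nu> \<in> P2" "dist q p < \<delta>" "W2 \<nu> \<mu> < \<delta>" for q :: "'a \<times> 'd" and \<nu>
    using that by (intro \<delta> le_less_trans[OF dist_fst_le])
  with \<open>0 < \<delta>\<close> show "\<exists>\<delta>>0. \<forall>q. \<forall>\<nu>\<in>P2. dist q p < \<delta> \<and> W2 \<nu> \<mu> < \<delta> \<longrightarrow>
      dist ((case q of (x, u) \<Rightarrow> \<lambda>\<mu>. f x \<mu>) \<nu>) ((case p of (x, u) \<Rightarrow> \<lambda>\<mu>. f x \<mu>) \<mu>) < \<epsilon>"
    by (intro exI[of _ \<delta>]) (auto simp: split_beta)
qed

lemma (in random_evolution) AE_path_integral_diff:
  fixes u v :: "real \<Rightarrow> 'a \<Rightarrow> 'b::euclidean_space"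
  assumes u: "integrable (N \<Otimes>\<^sub>M M) (\<lambda>(s, \<omega>). u s \<omega>)" and v: "integrable (N \<Otimes>\<^sub>M M) (\<lambda>(s, \<omega>). v s \<omega>)"
    and ab: "0 \<le> a" "b \<le> T"
  shows "AE \<omega> in M. (LINT s:{a..b}|N. u s \<omega> - v s \<omega>)
    = (LINT s:{a..b}|lborel. u s \<omega>) - (LINT s:{a..b}|lborel. v s \<omega>)"
  using AE_integrable_snd[OF u] AE_integrable_snd[OF v]
proof eventually_elim
  fix \<omega> assume *: "integrable N (\<lambda>s. u s \<omega>)" "integrable N (\<lambda>s. v s \<omega>)"
  have "set_integrable N {a..b} w" if "integrable N w" for w :: "real \<Rightarrow> 'b"
    unfolding set_integrable_def
  proof (rule Bochner_Integration.integrable_bound[OF that])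
    have [measurable]: "w \<in> borel_measurable N" using that by simp
    have [measurable]: "Measurable.pred N (\<lambda>s. s \<in> {a..b})"
      by (rule measurable_pred_time_interval) simp
    show "(\<lambda>s. indicat_real {a..b} s *\<^sub>R w s) \<in> borel_measurable N" by measurable
  qed (auto simp: indicator_def)
  from set_integral_diff(2)[OF this[OF *(1)] this[OF *(2)]]
  show "(LINT s:{a..b}|N. u s \<omega> - v s \<omega>)
      = (LINT s:{a..b}|lborel. u s \<omega>) - (LINT s:{a..b}|lborel. v s \<omega>)"
    using ab by (simp add: set_integral_time_interval)
qed

text \<open>The noise $\sigma B$ cancels from the forward equation. In the backward equation the difference of the
  two Ito integrals over $[t,T]$ is orthogonal to all square integrable variables known at time $t$;
  the values of $f$, $g$ and $V$ at time $t$ are such variables, because the lifts evaluate continuous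
  functions at adapted processes and deterministic laws.\<close>

lemma strong_solutions_coupled:
  fixes B :: "real \<Rightarrow> 'a \<Rightarrow> real^'n"
  assumes M: "prob_space M" and T: "0 < T"
    and W0: "continuous_P2 W0" and F: "continuous_P2 (\<lambda>(x, u) \<mu>. F x \<mu> u)"
    and G: "continuous_P2 (\<lambda>(x, u) \<mu>. G x \<mu> u)"
    and growth: "\<And>x \<mu> u. \<mu> \<in> P2 \<Longrightarrow>
      norm (W0 x \<mu>) + norm (F x \<mu> u) + norm (G x \<mu> u) \<le> C * (1 + norm x + norm u + sqrt (E2 \<mu>))"
    and \<F>: "sub_filtration M \<F>" and B: "brownian_motion M \<F> T B"
    and X0: "X0 \<in> L2_rv M" "X0 \<in> borel_measurable (\<F> 0)"
    and Y0: "Y0 \<in> L2_rv M" "Y0 \<in> borel_measurable (\<F> 0)"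
    and X: "strong_solution M \<F> B T \<sigma> W0 F G X0 X Wx Zx"
    and Y: "strong_solution M \<F> B T \<sigma> W0 F G Y0 Y Wy Zy"
  obtains I where "coupled_differences T M
      (\<lambda>s \<omega>. lift M F (X s) (Wx s) \<omega> - lift M F (Y s) (Wy s) \<omega>)
      (\<lambda>s \<omega>. lift M G (X s) (Wx s) \<omega> - lift M G (Y s) (Wy s) \<omega>)
      (\<lambda>s \<omega>. X s \<omega> - Y s \<omega>) (\<lambda>s \<omega>. Wx s \<omega> - Wy s \<omega>) I
      (\<lambda>\<omega>. lift0 M W0 (X T) \<omega> - lift0 M W0 (Y T) \<omega>) (\<lambda>\<omega>. X0 \<omega> - Y0 \<omega>)"
    and "L2_process (time_interval 0 T) M (\<lambda>s \<omega>. X s \<omega> - Y s \<omega>)"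
    and "L2_process (time_interval 0 T) M (\<lambda>s \<omega>. Wx s \<omega> - Wy s \<omega>)"
proof -
  interpret random_evolution T M
    using M by (simp add: random_evolution_def time_randomness_def finite_measure_time_interval)
  have growths: "norm (F x \<mu> u) \<le> C * (1 + norm x + norm u + sqrt (E2 \<mu>))"
    "norm (G x \<mu> u) \<le> C * (1 + norm x + norm u + sqrt (E2 \<mu>))"
    "norm (W0 x \<mu>) \<le> C * (1 + norm x + norm u + sqrt (E2 \<mu>))" if "\<mu> \<in> P2" for x \<mu> u
    using growth[OF that, of x u] norm_ge_zero[of "W0 x \<mu>"] norm_ge_zero[of "F x \<mu> u"]
      norm_ge_zero[of "G x \<mu> u"] by linarith+
  have processes: "L2_process N M P" if "sq_int_process M \<F> T P" "\<And>t. t \<in> {0..T} \<Longrightarrow> P t \<in> L2_rv M"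
    for P :: "real \<Rightarrow> 'a \<Rightarrow> real^'n"
    using that by (simp add: L2_process_def sq_int_process_def)
  have Xs: "L2_process N M X" "L2_process N M Wx" "L2_process N M Y" "L2_process N M Wy"
    using X Y by (auto intro!: processes simp: strong_solution_def)
  have L2: "X t \<in> L2_rv M" "Wx t \<in> L2_rv M" "Y t \<in> L2_rv M" "Wy t \<in> L2_rv M" if "t \<in> {0..T}" for t
    using Xs[THEN L2_processD(2)] that by auto
  have adapted: "X t \<in> borel_measurable (\<F> t)" "Wx t \<in> borel_measurable (\<F> t)"
    "Y t \<in> borel_measurable (\<F> t)" "Wy t \<in> borel_measurable (\<F> t)" if "t \<in> {0..T}" for t
    using X Y that by (auto simp: strong_solution_def sq_int_process_def)
  have int: "integrable (N \<Otimes>\<^sub>M M) (\<lambda>(s, \<omega>). lift M F (X s) (Wx s) \<omega>)"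
    "integrable (N \<Otimes>\<^sub>M M) (\<lambda>(s, \<omega>). lift M G (X s) (Wx s) \<omega>)"
    "integrable (N \<Otimes>\<^sub>M M) (\<lambda>(s, \<omega>). lift M F (Y s) (Wy s) \<omega>)"
    "integrable (N \<Otimes>\<^sub>M M) (\<lambda>(s, \<omega>). lift M G (Y s) (Wy s) \<omega>)"
    using X Y unfolding strong_solution_def by blast+
  have "\<forall>t\<in>{0..T}. \<exists>I. has_ito_integral M \<F> B t T Zx I \<and>
      (AE \<omega> in M. Wx t \<omega> = lift0 M W0 (X T) \<omega>
        + (LINT s:{t..T}|lborel. lift M G (X s) (Wx s) \<omega>) - I \<omega>)"
    using X unfolding strong_solution_def by blast
  from bchoice[OF this] obtain Ix where Ix: "\<And>t. t \<in> {0..T} \<Longrightarrow> has_ito_integral M \<F> B t T Zx (Ix t)"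
    "\<And>t. t \<in> {0..T} \<Longrightarrow> AE \<omega> in M. Wx t \<omega> = lift0 M W0 (X T) \<omega>
            + (LINT s:{t..T}|lborel. lift M G (X s) (Wx s) \<omega>) - Ix t \<omega>"
    by blast
  have "\<forall>t\<in>{0..T}. \<exists>I. has_ito_integral M \<F> B t T Zy I \<and>
      (AE \<omega> in M. Wy t \<omega> = lift0 M W0 (Y T) \<omega>
        + (LINT s:{t..T}|lborel. lift M G (Y s) (Wy s) \<omega>) - I \<omega>)"
    using Y unfolding strong_solution_def by blast
  from bchoice[OF this] obtain Iy where Iy: "\<And>t. t \<in> {0..T} \<Longrightarrow> has_ito_integral M \<F> B t T Zy (Iy t)"
    "\<And>t. t \<in> {0..T} \<Longrightarrow> AE \<omega> in M. Wy t \<omega> = lift0 M W0 (Y T) \<omega>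
            + (LINT s:{t..T}|lborel. lift M G (Y s) (Wy s) \<omega>) - Iy t \<omega>"
    by blast
  have IL2: "Ix t \<in> L2_rv M" "Iy t \<in> L2_rv M" if "t \<in> {0..T}" for t
    using Ix(1)[OF that] Iy(1)[OF that] by (auto simp: has_ito_integral_def)
  have orth: "L2_inner M c (\<lambda>\<omega>. Ix t \<omega> - Iy t \<omega>) = 0"
    if "t \<in> {0..T}" "c \<in> L2_rv M" "c \<in> borel_measurable (\<F> t)" for c t
    using ito_integral_orthogonal[OF M \<F> B _ _ Ix(1)[OF that(1)] that(2,3)]
      ito_integral_orthogonal[OF M \<F> B _ _ Iy(1)[OF that(1)] that(2,3)] that IL2[OF that(1)]
    by (simp add: L2_inner_diff_right)
  have f: "L2_process N M (\<lambda>s \<omega>. lift M F (X s) (Wx s) \<omega> - lift M F (Y s) (Wy s) \<omega>)"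
    using Xs int by (intro L2_process_diff lift_L2_process[OF F growths(1)]) auto
  have g: "L2_process N M (\<lambda>s \<omega>. lift M G (X s) (Wx s) \<omega> - lift M G (Y s) (Wy s) \<omega>)"
    using Xs int by (intro L2_process_diff lift_L2_process[OF G growths(2)]) auto
  have "coupled_differences_axioms T M
      (\<lambda>s \<omega>. lift M F (X s) (Wx s) \<omega> - lift M F (Y s) (Wy s) \<omega>)
      (\<lambda>s \<omega>. lift M G (X s) (Wx s) \<omega> - lift M G (Y s) (Wy s) \<omega>)
      (\<lambda>s \<omega>. X s \<omega> - Y s \<omega>) (\<lambda>s \<omega>. Wx s \<omega> - Wy s \<omega>) (\<lambda>s \<omega>. Ix s \<omega> - Iy s \<omega>)
      (\<lambda>\<omega>. lift0 M W0 (X T) \<omega> - lift0 M W0 (Y T) \<omega>) (\<lambda>\<omega>. X0 \<omega> - Y0 \<omega>)"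
  proof (rule coupled_differences_axioms.intro[OF _ f g])
    show "0 \<le> T" using T by simp
    show "(\<lambda>\<omega>. lift0 M W0 (X T) \<omega> - lift0 M W0 (Y T) \<omega>) \<in> L2_rv M"
      unfolding lift0_eq_lift using L2[of T] T
      by (intro L2_rv_diff lift_L2[OF M continuous_P2_fst[OF W0] growths(3)]) auto
    show "(\<lambda>\<omega>. X0 \<omega> - Y0 \<omega>) \<in> L2_rv M" using X0 Y0 by auto
    show "L2_inner M (\<lambda>\<omega>. X0 \<omega> - Y0 \<omega>) (\<lambda>\<omega>. Ix 0 \<omega> - Iy 0 \<omega>) = 0"
      using X0 Y0 T by (intro orth borel_measurable_diff) auto
    fix t assume t: "t \<in> {0..T}"
    show "(\<lambda>\<omega>. X t \<omega> - Y t \<omega>) \<in> L2_rv M" "(\<lambda>\<omega>. Wx t \<omega> - Wy t \<omega>) \<in> L2_rv M"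
      "(\<lambda>\<omega>. Ix t \<omega> - Iy t \<omega>) \<in> L2_rv M"
      using L2[OF t] IL2[OF t] by auto
    show "L2_inner M (\<lambda>\<omega>. Wx t \<omega> - Wy t \<omega>) (\<lambda>\<omega>. Ix t \<omega> - Iy t \<omega>) = 0"
      using L2[OF t] adapted[OF t] by (intro orth t borel_measurable_diff) auto
    show "L2_inner M (\<lambda>\<omega>. lift M F (X t) (Wx t) \<omega> - lift M F (Y t) (Wy t) \<omega>)
        (\<lambda>\<omega>. Ix t \<omega> - Iy t \<omega>) = 0"
      using L2[OF t] adapted[OF t] L2_processD(2)[OF f] t
      by (intro orth t borel_measurable_diff lift_measurable[OF M F]) auto
    show "L2_inner M (\<lambda>\<omega>. lift M G (X t) (Wx t) \<omega> - lift M G (Y t) (Wy t) \<omega>)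
        (\<lambda>\<omega>. Ix t \<omega> - Iy t \<omega>) = 0"
      using L2[OF t] adapted[OF t] L2_processD(2)[OF g] t
      by (intro orth t borel_measurable_diff lift_measurable[OF M G]) auto
    have "AE \<omega> in M. X t \<omega> = X0 \<omega> - (LINT s:{0..t}|lborel. lift M F (X s) (Wx s) \<omega>) + \<sigma> *\<^sub>R B t \<omega>"
      "AE \<omega> in M. Y t \<omega> = Y0 \<omega> - (LINT s:{0..t}|lborel. lift M F (Y s) (Wy s) \<omega>) + \<sigma> *\<^sub>R B t \<omega>"
      using X Y t by (auto simp: strong_solution_def)
    moreover have "AE \<omega> in M.
        (LINT s:{0..t}|N. lift M F (X s) (Wx s) \<omega> - lift M F (Y s) (Wy s) \<omega>)
        = (LINT s:{0..t}|lborel. lift M F (X s) (Wx s) \<omega>)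
          - (LINT s:{0..t}|lborel. lift M F (Y s) (Wy s) \<omega>)"
      using t by (intro AE_path_integral_diff int) auto
    ultimately show "AE \<omega> in M. X t \<omega> - Y t \<omega> = X0 \<omega> - Y0 \<omega>
        - (LINT s:{0..t}|N. lift M F (X s) (Wx s) \<omega> - lift M F (Y s) (Wy s) \<omega>)"
      by eventually_elim simp
    have "AE \<omega> in M.
        (LINT s:{t..T}|N. lift M G (X s) (Wx s) \<omega> - lift M G (Y s) (Wy s) \<omega>)
        = (LINT s:{t..T}|lborel. lift M G (X s) (Wx s) \<omega>)
          - (LINT s:{t..T}|lborel. lift M G (Y s) (Wy s) \<omega>)"
      using t by (intro AE_path_integral_diff int) auto
    with Ix(2)[OF t] Iy(2)[OF t]
    show "AE \<omega> in M. Wx t \<omega> - Wy t \<omega> = lift0 M W0 (X T) \<omega> - lift0 M W0 (Y T) \<omega>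
        + (LINT s:{t..T}|N. lift M G (X s) (Wx s) \<omega> - lift M G (Y s) (Wy s) \<omega>)
        - (Ix t \<omega> - Iy t \<omega>)"
      by eventually_elim simp
  qed
  then show thesis
    using Xs by (intro that coupled_differences.intro L2_process_diff random_evolution_axioms)
qed

theorem lemma3p30:
  fixes M :: "'a measure"
    and T C\<^sub>1 C\<^sub>2 \<alpha> L \<gamma> :: real
    and w :: "real \<Rightarrow> real"
    and W0 :: "real^'n \<Rightarrow> (real^'n) measure \<Rightarrow> real^'n"
    and F G :: "real^'n \<Rightarrow> (real^'n) measure \<Rightarrow> real^'n \<Rightarrow> real^'n"
  assumes rich: "rich_prob_space M"
    and T: "T > 0"
    and cont_W0: "continuous_P2 W0"
    and cont_F: "continuous_P2 (\<lambda>(x, u) \<mu>. F x \<mu> u)"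
    and cont_G: "continuous_P2 (\<lambda>(x, u) \<mu>. G x \<mu> u)"
    and growth: "\<And>x \<mu> u. \<mu> \<in> P2 \<Longrightarrow>
      norm (W0 x \<mu>) + norm (F x \<mu> u) + norm (G x \<mu> u)
        \<le> C\<^sub>1 * (1 + norm x + norm u + sqrt (E2 \<mu>))"
    and \<alpha>: "\<alpha> > 0" and L: "L \<ge> 0"
    and mono_W0: "\<And>X Y. X \<in> L2_rv M \<Longrightarrow> Y \<in> L2_rv M \<Longrightarrow>
      L2_inner M (\<lambda>\<omega>. lift0 M W0 X \<omega> - lift0 M W0 Y \<omega>) (\<lambda>\<omega>. X \<omega> - Y \<omega>) \<ge> 0"
    and mono_GF: "\<And>X Y U V. X \<in> L2_rv M \<Longrightarrow> Y \<in> L2_rv M \<Longrightarrow> U \<in> L2_rv M \<Longrightarrow> V \<in> L2_rv M \<Longrightarrow>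
      L2_inner M (\<lambda>\<omega>. lift M G X U \<omega> - lift M G Y V \<omega>) (\<lambda>\<omega>. X \<omega> - Y \<omega>)
      + L2_inner M (\<lambda>\<omega>. lift M F X U \<omega> - lift M F Y V \<omega>) (\<lambda>\<omega>. U \<omega> - V \<omega>) \<ge> 0"
    and strong_mono_GF: "\<And>X Y U V. X \<in> L2_rv M \<Longrightarrow> Y \<in> L2_rv M \<Longrightarrow> U \<in> L2_rv M \<Longrightarrow> V \<in> L2_rv M \<Longrightarrow>
      L2_inner M (\<lambda>\<omega>. lift M G X U \<omega> - lift M G Y V \<omega>) (\<lambda>\<omega>. X \<omega> - Y \<omega>)
      + L2_inner M (\<lambda>\<omega>. lift M F X U \<omega> - lift M F Y V \<omega>) (\<lambda>\<omega>. U \<omega> - V \<omega>)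
      \<ge> \<alpha> * (L2_nrm M (\<lambda>\<omega>. U \<omega> - V \<omega>))\<^sup>2 - L * (L2_nrm M (\<lambda>\<omega>. X \<omega> - Y \<omega>))\<^sup>2"
    and \<gamma>: "0 < \<gamma>" "\<gamma> \<le> 1"
    and w: "modulus_of_continuity w"
    and G_upper: "\<And>X Y U V. X \<in> L2_rv M \<Longrightarrow> Y \<in> L2_rv M \<Longrightarrow> U \<in> L2_rv M \<Longrightarrow> V \<in> L2_rv M \<Longrightarrow>
      L2_inner M (\<lambda>\<omega>. lift M G X U \<omega> - lift M G Y V \<omega>) (\<lambda>\<omega>. U \<omega> - V \<omega>)
      \<le> C\<^sub>2 * ((L2_nrm_exp M \<gamma> (\<lambda>\<omega>. X \<omega> - Y \<omega>))\<^sup>2 + (L2_nrm M (\<lambda>\<omega>. U \<omega> - V \<omega>))\<^sup>2)"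
    and F_lower: "\<And>X Y U V. X \<in> L2_rv M \<Longrightarrow> Y \<in> L2_rv M \<Longrightarrow> U \<in> L2_rv M \<Longrightarrow> V \<in> L2_rv M \<Longrightarrow>
      L2_inner M (\<lambda>\<omega>. lift M F X U \<omega> - lift M F Y V \<omega>) (\<lambda>\<omega>. X \<omega> - Y \<omega>)
      \<ge> - C\<^sub>2 * ((L2_nrm M (\<lambda>\<omega>. X \<omega> - Y \<omega>))\<^sup>2 + (L2_nrm M (\<lambda>\<omega>. U \<omega> - V \<omega>))\<^sup>2)"
    and W0_hoelder: "\<And>X Y. X \<in> L2_rv M \<Longrightarrow> Y \<in> L2_rv M \<Longrightarrow>
      L2_nrm M (\<lambda>\<omega>. lift0 M W0 X \<omega> - lift0 M W0 Y \<omega>) \<le> C\<^sub>2 * L2_nrm_exp M \<gamma> (\<lambda>\<omega>. X \<omega> - Y \<omega>)"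
    and measure_modulus: "\<And>x u \<mu> \<nu>. \<mu> \<in> P2 \<Longrightarrow> \<nu> \<in> P2 \<Longrightarrow>
      norm (F x \<mu> u - F x \<nu> u) + norm (G x \<mu> u - G x \<nu> u) + norm (W0 x \<mu> - W0 x \<nu>)
        \<le> w (W2 \<mu> \<nu>)"
  shows "\<exists>C::real. \<forall>\<sigma>\<^sub>x \<F> B X\<^sub>0 Y\<^sub>0 X Y W\<^sub>x W\<^sub>y Z\<^sub>x Z\<^sub>y.
    \<sigma>\<^sub>x \<ge> 0 \<and>
    sub_filtration M \<F> \<and> brownian_motion M \<F> T B \<and>
    X\<^sub>0 \<in> L2_rv M \<and> X\<^sub>0 \<in> borel_measurable (\<F> 0) \<and>
    Y\<^sub>0 \<in> L2_rv M \<and> Y\<^sub>0 \<in> borel_measurable (\<F> 0) \<and>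
    strong_solution M \<F> B T \<sigma>\<^sub>x W0 F G X\<^sub>0 X W\<^sub>x Z\<^sub>x \<and>
    strong_solution M \<F> B T \<sigma>\<^sub>x W0 F G Y\<^sub>0 Y W\<^sub>y Z\<^sub>y
    \<longrightarrow> (\<forall>t\<in>{0..T}.
      L2_nrm M (\<lambda>\<omega>. W\<^sub>x t \<omega> - W\<^sub>y t \<omega>)
        \<le> C * L2_nrm_exp M (\<gamma> / (2 - \<gamma>)) (\<lambda>\<omega>. X\<^sub>0 \<omega> - Y\<^sub>0 \<omega>) \<and>
      L2_nrm M (\<lambda>\<omega>. X t \<omega> - Y t \<omega>)
        \<le> C * L2_nrm_exp M (1 / (2 - \<gamma>)) (\<lambda>\<omega>. X\<^sub>0 \<omega> - Y\<^sub>0 \<omega>))"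
proof -
  have M: "prob_space M" using rich by (simp add: rich_prob_space_def)
  \<comment> \<open>$C_2$ may be negative; a larger constant preserves all bounds, and one above $1$ makes the
    resulting factors at least $1$.\<close>
  define C where "C = max 1 C\<^sub>2"
  define K where "K = backward_const C \<alpha> L T"
  have C: "1 \<le> C" "C\<^sub>2 \<le> C" by (auto simp: C_def)
  note const_ge = backward_const_ge[OF C(1) \<alpha> L less_imp_le[OF T]]
  have K: "1 \<le> K" using const_ge by (simp add: K_def)
  have C_mono: "C\<^sub>2 * r \<le> C * r" if "0 \<le> r" for r using C that by (intro mult_right_mono)
  have "L2_nrm M (\<lambda>\<omega>. W\<^sub>x t \<omega> - W\<^sub>y t \<omega>)
        \<le> sqrt (K * (2 * K + 1)) * L2_nrm_exp M (\<gamma> / (2 - \<gamma>)) (\<lambda>\<omega>. X\<^sub>0 \<omega> - Y\<^sub>0 \<omega>) \<and>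
      L2_nrm M (\<lambda>\<omega>. X t \<omega> - Y t \<omega>)
        \<le> sqrt (K * (2 * K + 1)) * L2_nrm_exp M (1 / (2 - \<gamma>)) (\<lambda>\<omega>. X\<^sub>0 \<omega> - Y\<^sub>0 \<omega>)"
    if \<F>: "sub_filtration M \<F>" and B: "brownian_motion M \<F> T B"
      and X\<^sub>0: "X\<^sub>0 \<in> L2_rv M" "X\<^sub>0 \<in> borel_measurable (\<F> 0)"
      and Y\<^sub>0: "Y\<^sub>0 \<in> L2_rv M" "Y\<^sub>0 \<in> borel_measurable (\<F> 0)"
      and X: "strong_solution M \<F> B T \<sigma>\<^sub>x W0 F G X\<^sub>0 X W\<^sub>x Z\<^sub>x"
      and Y: "strong_solution M \<F> B T \<sigma>\<^sub>x W0 F G Y\<^sub>0 Y W\<^sub>y Z\<^sub>y"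
      and t: "t \<in> {0..T}"
    for \<sigma>\<^sub>x \<F> B X\<^sub>0 Y\<^sub>0 X Y W\<^sub>x W\<^sub>y Z\<^sub>x Z\<^sub>y t
  proof -
    let ?x = "\<lambda>s \<omega>. X s \<omega> - Y s \<omega>" and ?V = "\<lambda>s \<omega>. W\<^sub>x s \<omega> - W\<^sub>y s \<omega>"
    let ?d = "\<lambda>\<omega>. X\<^sub>0 \<omega> - Y\<^sub>0 \<omega>"
    obtain I where coupled: "coupled_differences T M
        (\<lambda>s \<omega>. lift M F (X s) (W\<^sub>x s) \<omega> - lift M F (Y s) (W\<^sub>y s) \<omega>)
        (\<lambda>s \<omega>. lift M G (X s) (W\<^sub>x s) \<omega> - lift M G (Y s) (W\<^sub>y s) \<omega>)
        ?x ?V I (\<lambda>\<omega>. lift0 M W0 (X T) \<omega> - lift0 M W0 (Y T) \<omega>) ?d"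
      and procs: "L2_process (time_interval 0 T) M ?x" "L2_process (time_interval 0 T) M ?V"
      using strong_solutions_coupled[OF M T cont_W0 cont_F cont_G growth \<F> B X\<^sub>0 Y\<^sub>0 X Y] by blast
    have L2: "X s \<in> L2_rv M" "W\<^sub>x s \<in> L2_rv M" "Y s \<in> L2_rv M" "W\<^sub>y s \<in> L2_rv M"
      if "s \<in> {0..T}" for s
      using X Y that by (auto simp: strong_solution_def)
    have T0: "T \<in> {0..T}" "0 \<in> {0..T}" using T by auto
    define a e where "a = L2_nrm M (?V 0)" and "e = L2_nrm M ?d"
    let ?S = "a * e + e\<^sup>2"
    have terminal: "0 \<le> L2_inner M (\<lambda>\<omega>. lift0 M W0 (X T) \<omega> - lift0 M W0 (Y T) \<omega>) (?x T)"
      using L2[OF T0(1)] by (intro mono_W0)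
    have "L2_nrm M (\<lambda>\<omega>. lift0 M W0 (X T) \<omega> - lift0 M W0 (Y T) \<omega>)
        \<le> C\<^sub>2 * L2_nrm_exp M \<gamma> (?x T)"
      using L2[OF T0(1)] by (intro W0_hoelder)
    also have "\<dots> \<le> C * L2_nrm_exp M \<gamma> (?x T)"
      by (rule C_mono) (auto simp: L2_nrm_exp_def le_max_iff_disj)
    finally have h_le: "L2_nrm M (\<lambda>\<omega>. lift0 M W0 (X T) \<omega> - lift0 M W0 (Y T) \<omega>)
        \<le> C * L2_nrm_exp M \<gamma> (?x T)" .
    have mono: "0 \<le> L2_inner M (\<lambda>\<omega>. lift M G (X r) (W\<^sub>x r) \<omega> - lift M G (Y r) (W\<^sub>y r) \<omega>) (?x r)
        + L2_inner M (\<lambda>\<omega>. lift M F (X r) (W\<^sub>x r) \<omega> - lift M F (Y r) (W\<^sub>y r) \<omega>) (?V r)"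
      if r: "r \<in> {0..T}" for r
      by (rule mono_GF[OF L2(1)[OF r] L2(3)[OF r] L2(2)[OF r] L2(4)[OF r]])
    have strong: "\<alpha> * (L2_nrm M (?V r))\<^sup>2 - L * (L2_nrm M (?x r))\<^sup>2
        \<le> L2_inner M (\<lambda>\<omega>. lift M G (X r) (W\<^sub>x r) \<omega> - lift M G (Y r) (W\<^sub>y r) \<omega>) (?x r)
        + L2_inner M (\<lambda>\<omega>. lift M F (X r) (W\<^sub>x r) \<omega> - lift M F (Y r) (W\<^sub>y r) \<omega>) (?V r)"
      if r: "r \<in> {0..T}" for r
      by (rule strong_mono_GF[OF L2(1)[OF r] L2(3)[OF r] L2(2)[OF r] L2(4)[OF r]])
    have lower: "- C * ((L2_nrm M (?x r))\<^sup>2 + (L2_nrm M (?V r))\<^sup>2)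
        \<le> L2_inner M (\<lambda>\<omega>. lift M F (X r) (W\<^sub>x r) \<omega> - lift M F (Y r) (W\<^sub>y r) \<omega>) (?x r)"
      if r: "r \<in> {0..T}" for r
      using F_lower[OF L2(1)[OF r] L2(3)[OF r] L2(2)[OF r] L2(4)[OF r]]
        C_mono[of "(L2_nrm M (?x r))\<^sup>2 + (L2_nrm M (?V r))\<^sup>2"] by simp
    have upper: "L2_inner M (\<lambda>\<omega>. lift M G (X r) (W\<^sub>x r) \<omega> - lift M G (Y r) (W\<^sub>y r) \<omega>) (?V r)
        \<le> C * ((L2_nrm_exp M \<gamma> (?x r))\<^sup>2 + (L2_nrm M (?V r))\<^sup>2)"
      if r: "r \<in> {0..T}" for r
      using G_upper[OF L2(1)[OF r] L2(3)[OF r] L2(2)[OF r] L2(4)[OF r]]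
        C_mono[of "(L2_nrm_exp M \<gamma> (?x r))\<^sup>2 + (L2_nrm M (?V r))\<^sup>2"] by simp
    have bounds: "(L2_nrm M (?x s))\<^sup>2 \<le> forward_const C \<alpha> L T * ?S
        \<and> (L2_nrm M (?V s))\<^sup>2 \<le> K * max ?S (?S powr \<gamma>)" if s: "s \<in> {0..T}" for s
      using coupled_differences.stability_estimates[OF coupled C(1) \<alpha> L \<gamma> procs
          terminal mono strong lower upper h_le s]
      unfolding K_def a_def e_def by blast
    \<comment> \<open>At time $0$ the backward estimate closes: it bounds $\|V_0\|$ by a quantity that contains
      $\|V_0\|$ to a lower power.\<close>
    have "a\<^sup>2 \<le> K * max ?S (?S powr \<gamma>)"
      using bounds[OF T0(2)] by (simp add: a_def)
    note closure = hoelder_closure[OF \<gamma> K _ _ this]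
    have ae: "0 \<le> a" "0 \<le> e" by (auto simp: a_def e_def)
    have "(L2_nrm M (?V t))\<^sup>2 \<le> K * ((2 * K + 1) * (max e (e powr (\<gamma> / (2 - \<gamma>))))\<^sup>2)"
      using bounds[OF t] closure(2)[OF ae] K by (smt (verit) mult_left_mono)
    then have V: "(L2_nrm M (?V t))\<^sup>2
        \<le> K * (2 * K + 1) * (L2_nrm_exp M (\<gamma> / (2 - \<gamma>)) ?d)\<^sup>2"
      by (simp add: L2_nrm_exp_def e_def mult.assoc)
    have "0 \<le> ?S" using ae by simp
    then have "(L2_nrm M (?x t))\<^sup>2 \<le> K * ?S"
      using bounds[OF t] const_ge(2) by (smt (verit) K_def mult_right_mono)
    also have "\<dots> \<le> K * ((2 * K + 1) * (max e (e powr (1 / (2 - \<gamma>))))\<^sup>2)"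
      using closure(1)[OF ae] K by (intro mult_left_mono) auto
    finally have x: "(L2_nrm M (?x t))\<^sup>2
        \<le> K * (2 * K + 1) * (L2_nrm_exp M (1 / (2 - \<gamma>)) ?d)\<^sup>2"
      by (simp add: L2_nrm_exp_def e_def mult.assoc)
    have root: "p \<le> sqrt k * q" if "p\<^sup>2 \<le> k * q\<^sup>2" "0 \<le> q" for p q k :: real
      using real_le_rsqrt[OF that(1)] that(2) by (simp add: real_sqrt_mult)
    show ?thesis
      by (intro conjI root V x) (auto simp: L2_nrm_exp_def le_max_iff_disj)
  qed
  then show ?thesis by (intro exI[of _ "sqrt (K * (2 * K + 1))"] allI impI ballI) blast
qed

end
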